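(* Let $\phi_{h,\xi}^{n-1}\in U_h^\Omega$ and $r_{h,\xi}^{n-1},s_{h,\xi}^{n-1}\in\mathbb{R}$ be given, under the assumptions on the domain, time discretization, partitions and potentials listed in the context. If $\xi\in[0,\infty)$, then any solution $(\phi_{h,\xi}^n,\mu_{h,\xi}^n,\theta_{h,\xi}^n,r_{h,\xi}^n,s_{h,\xi}^n)\in U_h^\Omega\times U_h^\Omega\times U_h^\Gamma\times\mathbb{R}\times\mathbb{R}$ of the discrete scheme (i)--(v) of the context, if it exists, satisfies $$\begin{aligned} &\tfrac12\int_\Omega|\nabla\phi_{h,\xi}^n|^2\,dx+\tfrac12\int_\Gamma|\nabla_\Gamma\phi_{h,\xi}^n|^2\,d\Gamma+|r_{h,\xi}^n|^2+|s_{h,\xi}^n|^2\\ &+\tfrac12\int_\Omega|\nabla\phi_{h,\xi}^n-\nabla\phi_{h,\xi}^{n-1}|^2\,dx+\tfrac12\int_\Gamma|\nabla_\Gamma\phi_{h,\xi}^n-\nabla_\Gamma\phi_{h,\xi}^{n-1}|^2\,d\Gamma+|r_{h,\xi}^n-r_{h,\xi}^{n-1}|^2+|s_{h,\xi}^n-s_{h,\xi}^{n-1}|^2\\ &+\tau\int_\Omega|\nabla\mu_{h,\xi}^n|^2\,dx+\tau\int_\Gamma|\nabla_\Gamma\theta_{h,\xi}^n|^2\,d\Gamma+\xi\tau\int_\Gamma\mathcal{I}_h^\Gamma\{|\beta\theta_{h,\xi}^n-\mu_{h,\xi}^n|^2\}\,d\Gamma\\ &=\tfrac12\int_\Omega|\nabla\phi_{h,\xi}^{n-1}|^2\,dx+\tfrac12\int_\Gamma|\nabla_\Gamma\phi_{h,\xi}^{n-1}|^2\,d\Gamma+|r_{h,\xi}^{n-1}|^2+|s_{h,\xi}^{n-1}|^2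 . \end{aligned}$$ If $\xi=\infty$, any solution satisfies the identity $$\begin{aligned} &\tfrac12\int_\Omega|\nabla\phi_{h,\xi}^n|^2\,dx+\tfrac12\int_\Gamma|\nabla_\Gamma\phi_{h,\xi}^n|^2\,d\Gamma+|r_{h,\xi}^n|^2+|s_{h,\xi}^n|^2\\ &+\tfrac12\int_\Omega|\nabla\phi_{h,\xi}^n-\nabla\phi_{h,\xi}^{n-1}|^2\,dx+\tfrac12\int_\Gamma|\nabla_\Gamma\phi_{h,\xi}^n-\nabla_\Gamma\phi_{h,\xi}^{n-1}|^2\,d\Gamma+|r_{h,\xi}^n-r_{h,\xi}^{n-1}|^2+|s_{h,\xi}^n-s_{h,\xi}^{n-1}|^2\\ &+\tau\int_\Omega|\nabla\mu_{h,\xi}^n|^2\,dx+\tau\int_\Gamma|\nabla_\Gamma\theta_{h,\xi}^n|^2\,d\Gamma\\ &=\tfrac12\int_\Omega|\nabla\phi_{h,\xi}^{n-1}|^2\,dx+\tfrac12\int_\Gamma|\nabla_\Gamma\phi_{h,\xi}^{n-1}|^2\,d\Gamma+|r_{h,\xi}^{n-1}|^2+|s_{h,\xi}^{n-1}|^2 , \end{aligned}$$ together with $\beta\theta_{h,\xi}^n\equiv\mu_{h,\xi}^n$ on $\Gamma$.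
   Context: **Domain and data.** $\Omega\subset\mathbb{R}^d$, $d\in\{2,3\}$, is a bounded, convex, polygonal (resp. polyhedral) domain, $\Gamma:=\partial\Omega$; $\nabla_\Gamma$ is the surface gradient on $\Gamma$; $\beta>0$ is a constant. The trace operator on $\Gamma$ is often suppressed in the notation. **Time discretization.** $T>0$, $N\in\mathbb{N}$, $\tau=T/N$, $t^n=n\tau$; $\partial_\tau^-a^n:=\tau^{-1}(a^n-a^{n-1})$. **Partitions.** $\{\mathcal{T}_h\}_{h>0}$ is a quasiuniform family of (conforming) partitions of $\Omega$ into disjoint open simplices $K$ with $\overline\Omega=\bigcup_{K}\overline K$, $\max_K\mathrm{diam}(K)\le h$. $\{\mathcal{T}_h^\Gamma\}_{h>0}$ is a quasiuniform family of partitions of $\Gamma$ into disjoint open simplices $K^\Gamma$ such that for every $K^\Gamma\in\mathcal{T}_h^\Gamma$ there is a unique $K\in\mathcal{T}_h$ with $\overline{K^\Gamma}=\overline K\cap\Gamma$, $\Gamma=\bigcup\overline{K^\Gamma}$, $\max\mathrm{diam}(K^\Gamma)\le h$ (so the elements of $\mathcal{T}_h^\Gamma$ are edges/faces of elements of $\mathcal{T}_h$). **Discrete spaces.** $U_h^\Omega$ is the space of continuous piecewise linear functions on $\mathcal{T}_h$; $U_h^\Gamma$ is the space of continuous piecewise linear functions on $\mathcal{T}_h^\Gamma$, i.e. the traces of functions in $U_h^\Omega$. $\mathcal{I}_h:C^0(\overline\Omega)\to U_h^\Omega$ and $\mathcal{I}_h^\Gamma:C^0(\Gamma)\to U_h^\Gamma$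 are the nodal interpolation operators (values at the vertices of $\mathcal{T}_h$, resp. $\mathcal{T}_h^\Gamma$). **Potentials.** $F,G\in C^1(\mathbb{R})$ satisfy: (a) there is $\gamma>0$ with $E_h^\Omega(\zeta_h):=\int_\Omega\mathcal{I}_h\{F(\zeta_h)\}\,dx\ge\gamma$ and $E_h^\Gamma(\tilde\zeta_h):=\int_\Gamma\mathcal{I}_h^\Gamma\{G(\tilde\zeta_h)\}\,d\Gamma\ge\gamma$ for all $\zeta_h\in U_h^\Omega$, $\tilde\zeta_h\in U_h^\Gamma$, uniformly in $h$; (b) $|F(\zeta)|,|G(\zeta)|\le C(1+|\zeta|^4)$ and $|F'(\zeta)|,|G'(\zeta)|\le C(1+|\zeta|^3)$; (c) $F=F_1+F_2$, $G=G_1+G_2$ with $F_1,G_1\in C^{1,1}(\mathbb{R})$, $F_2,G_2\in C^2(\mathbb{R})$, $|F_2''(\zeta)|,|G_2''(\zeta)|\le C(1+|\zeta|^2)$. **Discrete scheme.** Let $\xi\in[0,\infty]$ (for $\xi=\infty$: $\frac1{1+\xi}:=0$, $\frac{\xi}{1+\xi}:=1$). Given $(\phi_{h,\xi}^{n-1},r_{h,\xi}^{n-1},s_{h,\xi}^{n-1})\in U_h^\Omega\times\mathbb{R}\times\mathbb{R}$, find $(\phi_{h,\xi}^n,\mu_{h,\xi}^n,\theta_{h,\xi}^n,r_{h,\xi}^n,s_{h,\xi}^n)\in U_h^\Omega\times U_h^\Omega\times U_h^\Gamma\times\mathbb{R}\times\mathbb{R}$ such that for all $\psi_h,\hat\psi_h\in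 U_h^\Omega$, $\eta_h\in U_h^\Gamma$: (i) $\int_\Omega\mathcal{I}_h\{\partial_\tau^-\phi_{h,\xi}^n\psi_h\}dx+\int_\Omega\nabla\mu_{h,\xi}^n\cdot\nabla\psi_h\,dx+\beta^{-1}\int_\Gamma\mathcal{I}_h^\Gamma\{\partial_\tau^-\phi_{h,\xi}^n\psi_h\}d\Gamma+\beta^{-1}\int_\Gamma\nabla_\Gamma\theta_{h,\xi}^n\cdot\nabla_\Gamma\psi_h\,d\Gamma=0$; (ii) $\frac1{1+\xi}\int_\Gamma\mathcal{I}_h^\Gamma\{\partial_\tau^-\phi_{h,\xi}^n\eta_h\}d\Gamma+\frac1{1+\xi}\int_\Gamma\nabla_\Gamma\theta_{h,\xi}^n\cdot\nabla_\Gamma\eta_h\,d\Gamma+\frac{\xi}{1+\xi}\beta\int_\Gamma\mathcal{I}_h^\Gamma\{(\beta\theta_{h,\xi}^n-\mu_{h,\xi}^n)\eta_h\}d\Gamma=0$; (iii) $\int_\Omega\mathcal{I}_h\{\mu_{h,\xi}^n\hat\psi_h\}dx+\int_\Gamma\mathcal{I}_h^\Gamma\{\theta_{h,\xi}^n\hat\psi_h\}d\Gamma=\int_\Omega\nabla\phi_{h,\xi}^n\cdot\nabla\hat\psi_h\,dx+\int_\Gamma\nabla_\Gamma\phi_{h,\xi}^n\cdot\nabla_\Gamma\hat\psi_h\,d\Gamma+\frac{r_{h,\xi}^n}{\sqrt{E_h^\Omega(\phi_{h,\xi}^{n-1})}}\int_\Omega\mathcal{I}_h\{F'(\phi_{h,\xi}^{n-1})\hat\psi_h\}dx+\frac{s_{h,\xi}^n}{\sqrt{E_h^\Gamma(\phi_{h,\xi}^{n-1})}}\int_\Gamma\mathcal{I}_h^\Gamma\{G'(\phi_{h,\xi}^{n-1})\hat\psi_h\}d\Gamma$;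 (iv) $r_{h,\xi}^n=r_{h,\xi}^{n-1}+\frac1{2\sqrt{E_h^\Omega(\phi_{h,\xi}^{n-1})}}\int_\Omega\mathcal{I}_h\{F'(\phi_{h,\xi}^{n-1})(\phi_{h,\xi}^n-\phi_{h,\xi}^{n-1})\}dx$; (v) $s_{h,\xi}^n=s_{h,\xi}^{n-1}+\frac1{2\sqrt{E_h^\Gamma(\phi_{h,\xi}^{n-1})}}\int_\Gamma\mathcal{I}_h^\Gamma\{G'(\phi_{h,\xi}^{n-1})(\phi_{h,\xi}^n-\phi_{h,\xi}^{n-1})\}d\Gamma$. *)

theory Defs
  imports "HOL-Analysis.Analysis"
begin

section \<open>Surface measure\<close>

text \<open>
  The surface measure on the boundary of a \<open>d\<close>-dimensional domain is the \<open>(d - 1)\<close>-dimensional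
  Hausdorff measure, normalised so that it agrees with \<open>(d - 1)\<close>-dimensional Lebesgue measure on
  flat pieces.  The definitions are meant for dimensions \<open>k \<ge> 1\<close> only: for \<open>k = 0\<close> empty covering
  sets would contribute \<open>0 ^ 0 = 1\<close> to the sum.
\<close>

definition hausdorff_content :: "nat \<Rightarrow> real \<Rightarrow> 'a::metric_space set \<Rightarrow> ennreal" where
  "hausdorff_content k \<delta> A =
     (INF C\<in>{C :: nat \<Rightarrow> 'a set. A \<subseteq> (\<Union>i. C i) \<and> (\<forall>i. bounded (C i) \<and> diameter (C i) \<le> \<delta>)}.
        \<Sum>i. ennreal (unit_ball_vol (real k) * (diameter (C i) / 2) ^ k))"

definition hausdorff_outer :: "nat \<Rightarrow> 'a::metric_space set \<Rightarrow> ennreal" where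
  "hausdorff_outer k A = (SUP \<delta>\<in>{0<..}. hausdorff_content k \<delta> A)"

definition hausdorff_measure :: "nat \<Rightarrow> 'a::metric_space measure" where
  "hausdorff_measure k = measure_of UNIV (sets borel) (hausdorff_outer k)"

text \<open>
  The Hausdorff outer measure is countably additive on Borel sets, so that \<^const>\<open>measure_of\<close>
  above does not degenerate to the zero measure.
\<close>

lemma hausdorff_content_mono:
  "A \<subseteq> B \<Longrightarrow> hausdorff_content k \<delta> A \<le> hausdorff_content k \<delta> B"
  unfolding hausdorff_content_def by (rule INF_superset_mono) auto

lemma hausdorff_content_antimono:
  "\<delta> \<le> \<delta>' \<Longrightarrow> hausdorff_content k \<delta>' A \<le> hausdorff_content k \<delta> A"
  unfolding hausdorff_content_def by (rule INF_superset_mono) (auto intro: order_trans)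

lemma hausdorff_content_empty:
  assumes "k > 0" "\<delta> > 0"
  shows "hausdorff_content k \<delta> {} = 0"
proof -
  have "hausdorff_content k \<delta> {} \<le>
      (\<Sum>i::nat. ennreal (unit_ball_vol (real k) * (diameter ({} :: 'a set) / 2) ^ k))"
    unfolding hausdorff_content_def
    by (rule INF_lower2[where i="\<lambda>_. {}"]) (use assms in auto)
  also have "\<dots> = 0" using assms by (simp add: power_0_left)
  finally show ?thesis by simp
qed

lemma hausdorff_content_subadditive:
  fixes A :: "nat \<Rightarrow> 'a::metric_space set"
  shows "hausdorff_content k \<delta> (\<Union>i. A i) \<le> (\<Sum>i. hausdorff_content k \<delta> (A i))"
proof (rule ennreal_le_epsilon)
  fix e :: real
  assume fin: "(\<Sum>i. hausdorff_content k \<delta> (A i)) < top" and e: "0 < e"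
  define w where "w C = ennreal (unit_ball_vol (real k) * (diameter C / 2) ^ k)" for C :: "'a set"
  have "\<exists>C. A n \<subseteq> (\<Union>i. C i) \<and> (\<forall>i. bounded (C i) \<and> diameter (C i) \<le> \<delta>) \<and>
      (\<Sum>i::nat. w (C i)) \<le> hausdorff_content k \<delta> (A n) + ennreal (e * (1/2) ^ Suc n)" for n
  proof -
    have "hausdorff_content k \<delta> (A n) \<noteq> top"
      using fin by (metis ennreal_suminf_lessD less_irrefl)
    then have "hausdorff_content k \<delta> (A n)
        < hausdorff_content k \<delta> (A n) + ennreal (e * (1/2) ^ Suc n)"
      using e by (simp add: ennreal_add_left_cancel_less[of _ 0, simplified] less_top)
    then show ?thesis
      unfolding hausdorff_content_def[of k \<delta> "A n"] INF_less_iff w_def by (auto intro: less_imp_le)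
  qed
  then obtain C where C: "\<And>n. A n \<subseteq> (\<Union>i. C n i)"
      "\<And>n i. bounded (C n i) \<and> diameter (C n i) \<le> \<delta>"
      "\<And>n. (\<Sum>i. w (C n i)) \<le> hausdorff_content k \<delta> (A n) + ennreal (e * (1/2) ^ Suc n)"
    by metis
  define D where "D i = (case prod_decode i of (m, n) \<Rightarrow> C m n)" for i
  have D: "D (prod_encode (m, n)) = C m n" for m n by (simp add: D_def)
  have "(\<Union>n. A n) \<subseteq> (\<Union>i. D i)"
    using C(1) D by (fastforce simp: subset_eq)
  moreover have "bounded (D i) \<and> diameter (D i) \<le> \<delta>" for i
    using C(2) by (auto simp: D_def split: prod.split)
  ultimately have "hausdorff_content k \<delta> (\<Union>i. A i) \<le> (\<Sum>i. w (D i))"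
    unfolding hausdorff_content_def w_def by (intro INF_lower) auto
  also have "\<dots> = (\<Sum>i. (\<lambda>(m, n). w (C m n)) (prod_decode i))"
    by (simp add: D_def split_beta)
  also have "\<dots> = (\<Sum>m. \<Sum>n. w (C m n))"
    by (rule suminf_ennreal_2dimen) simp
  also have "\<dots> \<le> (\<Sum>m. hausdorff_content k \<delta> (A m) + ennreal (e * (1/2) ^ Suc m))"
    by (intro suminf_le C) auto
  also have "\<dots> = (\<Sum>m. hausdorff_content k \<delta> (A m)) + (\<Sum>m. ennreal (e * (1/2) ^ Suc m))"
    by (intro suminf_add[symmetric]) auto
  also have "(\<Sum>m. ennreal (e * (1/2) ^ Suc m)) = ennreal e"
    using e sums_mult[OF power_half_series, of e]
    by (intro suminf_ennreal_eq) auto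
  finally show "hausdorff_content k \<delta> (\<Union>i. A i) \<le> (\<Sum>i. hausdorff_content k \<delta> (A i)) + ennreal e" .
qed

lemma hausdorff_content_separated:
  fixes A B :: "'a::metric_space set"
  assumes k: "k > 0" and \<delta>: "0 < \<delta>" and sep: "\<And>a b. a \<in> A \<Longrightarrow> b \<in> B \<Longrightarrow> \<delta> < dist a b"
  shows "hausdorff_content k \<delta> A + hausdorff_content k \<delta> B \<le> hausdorff_content k \<delta> (A \<union> B)"
proof -
  define w where "w C = ennreal (unit_ball_vol (real k) * (diameter C / 2) ^ k)" for C :: "'a set"
  have w0: "w {} = 0" using k by (simp add: w_def)
  have "hausdorff_content k \<delta> A + hausdorff_content k \<delta> B \<le> (\<Sum>i. w (C i))"
    if cov: "A \<union> B \<subseteq> (\<Union>i. C i)" and C: "\<forall>i. bounded (C i) \<and> diameter (C i) \<le> \<delta>"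
    for C :: "nat \<Rightarrow> 'a set"
  proof -
    define P where "P i = (if C i \<inter> A = {} then {} else C i)" for i
    define Q where "Q i = (if C i \<inter> B = {} then {} else C i)" for i
    have disj: "C i \<inter> A = {} \<or> C i \<inter> B = {}" for i
    proof (rule ccontr)
      assume "\<not> ?thesis"
      then obtain a b where ab: "a \<in> C i" "a \<in> A" "b \<in> C i" "b \<in> B" by auto
      then have "dist a b \<le> \<delta>"
        using C diameter_bounded_bound[of "C i" a b] order_trans by blast
      with sep ab show False by force
    qed
    have "hausdorff_content k \<delta> A \<le> (\<Sum>i. w (P i))"
      unfolding hausdorff_content_def w_def
      by (rule INF_lower) (use cov C \<delta> in \<open>fastforce simp: P_def\<close>)
    moreover have "hausdorff_content k \<delta> B \<le> (\<Sum>i. w (Q i))"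
      unfolding hausdorff_content_def w_def
      by (rule INF_lower) (use cov C \<delta> in \<open>fastforce simp: Q_def\<close>)
    ultimately have "hausdorff_content k \<delta> A + hausdorff_content k \<delta> B
        \<le> (\<Sum>i. w (P i)) + (\<Sum>i. w (Q i))"
      by (rule add_mono)
    also have "\<dots> = (\<Sum>i. w (P i) + w (Q i))" by (intro suminf_add) auto
    also have "\<dots> \<le> (\<Sum>i. w (C i))"
      by (intro suminf_le) (use disj in \<open>auto simp: P_def Q_def w0\<close>)
    finally show ?thesis .
  qed
  then show ?thesis
    unfolding hausdorff_content_def[of k \<delta> "A \<union> B"] w_def by (intro INF_greatest) auto
qed

lemma hausdorff_outer_mono: "A \<subseteq> B \<Longrightarrow> hausdorff_outer k A \<le> hausdorff_outer k B"
  unfolding hausdorff_outer_def by (intro SUP_mono') (rule hausdorff_content_mono)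

lemma hausdorff_outer_subadditive:
  "hausdorff_outer k (\<Union>i. A i) \<le> (\<Sum>i. hausdorff_outer k (A i))"
  unfolding hausdorff_outer_def[of k "\<Union>i. A i"]
proof (rule SUP_least)
  fix \<delta> :: real assume "\<delta> \<in> {0<..}"
  then have "(\<Sum>i. hausdorff_content k \<delta> (A i)) \<le> (\<Sum>i. hausdorff_outer k (A i))"
    by (intro suminf_le) (auto simp: hausdorff_outer_def intro: SUP_upper)
  then show "hausdorff_content k \<delta> (\<Union>i. A i) \<le> (\<Sum>i. hausdorff_outer k (A i))"
    by (rule order_trans[OF hausdorff_content_subadditive])
qed

lemma hausdorff_outer_empty: "k > 0 \<Longrightarrow> hausdorff_outer k {} = 0"
  unfolding hausdorff_outer_def by (simp add: hausdorff_content_empty)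

lemma hausdorff_outer_separated:
  assumes k: "k > 0" and e: "0 < e" and sep: "\<And>a b. a \<in> A \<Longrightarrow> b \<in> B \<Longrightarrow> e \<le> dist a b"
  shows "hausdorff_outer k A + hausdorff_outer k B \<le> hausdorff_outer k (A \<union> B)"
proof -
  have red: "hausdorff_outer k X = (SUP \<delta>\<in>{0<..<e}. hausdorff_content k \<delta> X)" for X :: "'a set"
    unfolding hausdorff_outer_def
  proof (rule antisym; rule SUP_mono)
    fix \<delta> :: real assume "\<delta> \<in> {0<..}"
    then show "\<exists>\<epsilon>\<in>{0<..<e}. hausdorff_content k \<delta> X \<le> hausdorff_content k \<epsilon> X"
      using e by (intro bexI[of _ "min \<delta> (e / 2)"] hausdorff_content_antimono) auto
  qed auto
  have dir: "\<exists>k'\<in>{0<..<e}. hausdorff_content k i A + hausdorff_content k j B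
        \<le> hausdorff_content k k' A + hausdorff_content k k' B"
    if "i \<in> {0<..<e}" "j \<in> {0<..<e}" for i j
    using that by (intro bexI[of _ "min i j"] add_mono hausdorff_content_antimono) auto
  have "hausdorff_outer k A + hausdorff_outer k B
      = (SUP \<delta>\<in>{0<..<e}. hausdorff_content k \<delta> A + hausdorff_content k \<delta> B)"
    unfolding red using e dir by (intro SUP_add_directed_ennreal[symmetric]) auto
  also have "\<dots> \<le> hausdorff_outer k (A \<union> B)"
    unfolding red
  proof (rule SUP_mono)
    fix \<delta> :: real assume \<delta>: "\<delta> \<in> {0<..<e}"
    then have "hausdorff_content k \<delta> A + hausdorff_content k \<delta> B \<le> hausdorff_content k \<delta> (A \<union> B)"
      using sep by (intro hausdorff_content_separated[OF k]) force+
    with \<delta> show "\<exists>m\<in>{0<..<e}. hausdorff_content k \<delta> A + hausdorff_content k \<delta> B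
        \<le> hausdorff_content k m (A \<union> B)" by blast
  qed
  finally show ?thesis .
qed

lemma hausdorff_outer_Un:
  assumes "k > 0"
  shows "hausdorff_outer k (A \<union> B) \<le> hausdorff_outer k A + hausdorff_outer k B"
proof -
  define C where "C i = (if i = 0 then A else if i = 1 then B else {})" for i :: nat
  have "(\<Union>i. C i) = A \<union> B" by (auto simp: C_def split: if_splits)
  then have "hausdorff_outer k (A \<union> B) \<le> (\<Sum>i. hausdorff_outer k (C i))"
    using hausdorff_outer_subadditive[of k C] by simp
  also have "\<dots> = (\<Sum>i<2. hausdorff_outer k (C i))"
    by (rule suminf_finite) (auto simp: C_def hausdorff_outer_empty assms)
  finally show ?thesis by (simp add: C_def numeral_2_eq_2)
qed

lemma hausdorff_outer_closed_Caratheodory: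
  fixes F X :: "'a::metric_space set"
  assumes k: "k > 0" and F: "closed F"
  shows "hausdorff_outer k (X \<inter> F) + hausdorff_outer k (X - F) \<le> hausdorff_outer k X"
proof (cases "hausdorff_outer k X = top \<or> F = {}")
  case True
  then show ?thesis using k by (auto simp: hausdorff_outer_empty)
next
  case False
  let ?H = "hausdorff_outer k"
  have fin: "?H X < top" and ne: "F \<noteq> {}" using False by (auto simp: less_top)
  define A where "A n = {x \<in> X. 1 / real (Suc n) \<le> infdist x F}" for n
  define D where "D n = A (Suc n) - A n" for n
  have dF: "infdist x F \<le> dist x y + infdist y F" for x y
    using infdist_triangle[of x F y] by simp
  have sepA: "?H (X \<inter> F) + ?H (A n) \<le> ?H X" for n
  proof -
    have "?H (X \<inter> F) + ?H (A n) \<le> ?H ((X \<inter> F) \<union> A n)"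
    proof (rule hausdorff_outer_separated[OF k])
      show "0 < 1 / real (Suc n)" by simp
      fix a b assume "a \<in> X \<inter> F" "b \<in> A n"
      then show "1 / real (Suc n) \<le> dist a b"
        using infdist_le[of a F b] by (auto simp: A_def dist_commute)
    qed
    also have "\<dots> \<le> ?H X" by (rule hausdorff_outer_mono) (auto simp: A_def)
    finally show ?thesis .
  qed
  have mono_A: "A m \<subseteq> A n" if "m \<le> n" for m n
    using that unfolding A_def by (auto elim!: order_trans[rotated] intro!: divide_left_mono)
  have sepD: "\<exists>e>0. \<forall>a\<in>D m. \<forall>b\<in>A n. e \<le> dist a b" if "Suc n \<le> m" for m n
  proof (intro exI[of _ "1 / real (Suc n) - 1 / real (Suc m)"] conjI ballI)
    show "0 < 1 / real (Suc n) - 1 / real (Suc m)" using that by (simp add: frac_less2)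
    fix a b assume "a \<in> D m" "b \<in> A n"
    then have "infdist a F < 1 / real (Suc m)" "1 / real (Suc n) \<le> infdist b F"
      by (auto simp: D_def A_def)
    then show "1 / real (Suc n) - 1 / real (Suc m) \<le> dist a b"
      using dF[of b a] by (simp add: dist_commute)
  qed
  have alt: "(\<Sum>i<n. ?H (D (2 * i + 1 + j))) \<le> ?H (A (2 * n + j))" for n j
  proof (induction n)
    case (Suc n)
    obtain e where e: "e > 0" "\<forall>a\<in>D (2 * n + 1 + j). \<forall>b\<in>A (2 * n + j). e \<le> dist a b"
      using sepD[of "2 * n + j" "2 * n + 1 + j"] by auto
    have "(\<Sum>i<Suc n. ?H (D (2 * i + 1 + j))) \<le> ?H (D (2 * n + 1 + j)) + ?H (A (2 * n + j))"
      using Suc by (simp add: add.commute add_left_mono)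
    also have "\<dots> \<le> ?H (D (2 * n + 1 + j) \<union> A (2 * n + j))"
      using e by (intro hausdorff_outer_separated[OF k]) auto
    also have "\<dots> \<le> ?H (A (2 * Suc n + j))"
      using mono_A[of "2 * n + j" "2 * Suc n + j"]
      by (intro hausdorff_outer_mono) (auto simp: D_def)
    finally show ?case .
  qed simp
  define f where "f m = ?H (D (Suc m))" for m
  have AX: "?H (A n) \<le> ?H X" for n by (rule hausdorff_outer_mono) (auto simp: A_def)
  have split: "(\<Sum>m<2 * n. f m) = (\<Sum>i<n. ?H (D (2 * i + 1 + 0))) + (\<Sum>i<n. ?H (D (2 * i + 1 + 1)))"
    for n by (induction n) (auto simp: f_def add_ac)
  have bound: "(\<Sum>m<n. f m) \<le> ?H X + ?H X" for n
  proof -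
    have "(\<Sum>m<n. f m) \<le> (\<Sum>m<2 * n. f m)" by (intro sum_mono2) auto
    also have "\<dots> \<le> ?H X + ?H X"
      unfolding split by (intro add_mono order_trans[OF alt AX])
    finally show ?thesis .
  qed
  have "(\<Sum>m. f m) \<le> ?H X + ?H X"
    unfolding suminf_eq_SUP by (intro SUP_least bound)
  also have "\<dots> < top" using fin by simp
  finally have sum_fin: "(\<Sum>m. f m) < top" .
  have f_fin: "f m < top" for m using sum_fin by (rule ennreal_suminf_lessD)
  define g where "g m = enn2real (f m)" for m
  have fg: "f m = ennreal (g m)" and g0: "0 \<le> g m" for m
    using f_fin by (auto simp: g_def)
  have summ: "summable g"
    using sum_fin g0 unfolding fg by (intro summable_suminf_not_top) auto
  show ?thesis
  proof (rule ennreal_le_epsilon)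
    fix e :: real assume e: "0 < e"
    obtain n where n: "norm (\<Sum>i. g (i + n)) < e"
      using suminf_exist_split[OF e summ] by blast
    have tail: "(\<Sum>i. f (i + n)) \<le> ennreal e"
    proof -
      have "summable (\<lambda>i. g (i + n))" using summ by (simp add: summable_iff_shift)
      then have "(\<Sum>i. f (i + n)) = ennreal (\<Sum>i. g (i + n))"
        unfolding fg using g0 by (intro suminf_ennreal2) auto
      then show ?thesis using n by (simp add: ennreal_leI)
    qed
    have "X - F \<subseteq> A (Suc n) \<union> (\<Union>i. D (Suc (i + n)))"
    proof
      fix x assume x: "x \<in> X - F"
      then have "0 < infdist x F" using infdist_pos_not_in_closed[OF F ne] by auto
      then obtain m where "1 / real (Suc m) < infdist x F" by (rule nat_approx_posE)
      then have ex: "x \<in> A m" using x by (auto simp: A_def)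
      define p where "p = (LEAST m. x \<in> A m)"
      have p: "x \<in> A p" unfolding p_def using ex by (rule LeastI)
      show "x \<in> A (Suc n) \<union> (\<Union>i. D (Suc (i + n)))"
      proof (cases "p \<le> Suc n")
        case True
        then show ?thesis using p mono_A by blast
      next
        case False
        then obtain q where q: "p = Suc (Suc (q + n))"
          by (metis add.commute add_Suc_right less_iff_Suc_add not_le_imp_less)
        then have "x \<notin> A (Suc (q + n))"
          using not_less_Least[of "Suc (q + n)" "\<lambda>m. x \<in> A m"] by (auto simp: p_def)
        then show ?thesis using p q by (auto simp: D_def)
      qed
    qed
    then have "?H (X - F) \<le> ?H (A (Suc n) \<union> (\<Union>i. D (Suc (i + n))))"
      by (rule hausdorff_outer_mono)
    also have "\<dots> \<le> ?H (A (Suc n)) + ?H (\<Union>i. D (Suc (i + n)))"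
      by (rule hausdorff_outer_Un[OF k])
    also have "\<dots> \<le> ?H (A (Suc n)) + ennreal e"
      using order_trans[OF hausdorff_outer_subadditive tail[unfolded f_def]]
      by (rule add_left_mono)
    finally have "?H (X \<inter> F) + ?H (X - F) \<le> (?H (X \<inter> F) + ?H (A (Suc n))) + ennreal e"
      by (simp add: add.assoc add_left_mono)
    also have "\<dots> \<le> ?H X + ennreal e" by (intro add_right_mono sepA)
    finally show "?H (X \<inter> F) + ?H (X - F) \<le> ?H X + ennreal e" .
  qed
qed

lemma measure_space_hausdorff_outer:
  assumes k: "k > 0"
  shows "measure_space UNIV (sets (borel :: 'a::metric_space measure)) (hausdorff_outer k)"
proof -
  let ?H = "hausdorff_outer k :: 'a set \<Rightarrow> ennreal"
  let ?L = "lambda_system UNIV UNIV ?H"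
  interpret sigma_algebra "UNIV :: 'a set" "UNIV :: 'a set set"
    using sigma_algebra_Pow[of "UNIV :: 'a set"] by simp
  have "outer_measure_space UNIV ?H"
    unfolding outer_measure_space_def positive_def increasing_def countably_subadditive_def
    using k by (auto simp: hausdorff_outer_empty intro: hausdorff_outer_mono hausdorff_outer_subadditive)
  then have L: "measure_space UNIV ?L ?H" by (rule caratheodory_lemma)
  have "F \<in> ?L" if "closed F" for F
  proof -
    have "?H (X \<inter> F) + ?H (X - F) = ?H X" for X
    proof (rule antisym)
      show "?H (X \<inter> F) + ?H (X - F) \<le> ?H X"
        by (rule hausdorff_outer_closed_Caratheodory[OF k that])
      show "?H X \<le> ?H (X \<inter> F) + ?H (X - F)"
        using hausdorff_outer_Un[OF k, of "X \<inter> F" "X - F"] by (simp add: Int_Diff_Un)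
    qed
    then show ?thesis by (auto simp: lambda_system_eq)
  qed
  then have "sigma_sets UNIV (Collect closed) \<subseteq> ?L"
    using L by (intro sigma_algebra.sigma_sets_subset) (auto simp: measure_space_def)
  then have "sets borel \<subseteq> ?L" by (simp add: borel_eq_closed)
  moreover have "sigma_algebra UNIV (sets (borel :: 'a measure))"
    using sets.sigma_algebra_axioms[of "borel :: 'a measure"] by simp
  ultimately show ?thesis using measure_down[OF L] by blast
qed

lemma emeasure_hausdorff_measure:
  fixes A :: "'a::metric_space set"
  assumes "k > 0" "A \<in> sets borel"
  shows "emeasure (hausdorff_measure k) A = hausdorff_outer k A"
  using measure_space_hausdorff_outer[OF assms(1), where 'a='a] assms(2)
  unfolding hausdorff_measure_def measure_space_def
  by (intro emeasure_measure_of_sigma) auto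

text \<open>
  The completion makes a function that is determined only almost everywhere on the surface (such as
  the surface gradient of a piecewise linear function) measurable, as for \<^const>\<open>lebesgue\<close>.
\<close>

definition surface_measure :: "'a::euclidean_space measure" where
  "surface_measure = completion (hausdorff_measure (DIM('a) - 1))"


section \<open>Gradients\<close>

definition grad :: "('a::euclidean_space \<Rightarrow> real) \<Rightarrow> 'a \<Rightarrow> 'a" where
  "grad f x = (THE v. GDERIV f x :> v)"

text \<open>
  The span of the (Bouligand) tangent cone; at a point in the relative interior of a facet of a
  polyhedral surface this is the direction space of the facet.
\<close>

definition tangent_space :: "'a::euclidean_space set \<Rightarrow> 'a \<Rightarrow> 'a set" where
  "tangent_space S x =
     span {v. \<exists>y t. (\<forall>i. y i \<in> S \<and> 0 < t i) \<and> y \<longlonglongrightarrow> x \<and> (\<lambda>i::nat. t i *\<^sub>R (y i - x)) \<longlonglongrightarrow> v}"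

text \<open>
  Only the values of \<open>f\<close> on \<open>S\<close> matter.  The tangent vector \<open>v\<close> is unique, since the derivative
  within \<open>S\<close> determines \<open>v \<bullet> h\<close> for all tangential \<open>h\<close>.
\<close>

definition surface_grad :: "'a::euclidean_space set \<Rightarrow> ('a \<Rightarrow> real) \<Rightarrow> 'a \<Rightarrow> 'a" where
  "surface_grad S f x =
     (THE v. v \<in> tangent_space S x \<and> (f has_derivative (\<lambda>h. v \<bullet> h)) (at x within S))"


section \<open>Domain and partitions\<close>

definition convex_polytopal_domain :: "'a::euclidean_space set \<Rightarrow> bool" where
  "convex_polytopal_domain \<Omega> \<longleftrightarrow>
     \<Omega> \<noteq> {} \<and> open \<Omega> \<and> bounded \<Omega> \<and> convex \<Omega> \<and> polytope (closure \<Omega>)"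

definition open_simplex :: "nat \<Rightarrow> 'a::euclidean_space set \<Rightarrow> bool" where
  "open_simplex k K \<longleftrightarrow> (\<exists>S. int k simplex S \<and> K = rel_interior S)"

definition simplicial_partition :: "nat \<Rightarrow> 'a::euclidean_space set \<Rightarrow> 'a set set \<Rightarrow> bool" where
  "simplicial_partition k D T \<longleftrightarrow>
     finite T \<and> (\<forall>K\<in>T. open_simplex k K) \<and> pairwise disjnt T \<and> D = (\<Union>K\<in>T. closure K)"

text \<open>
  Quasiuniformity compares inradii with the actual maximal diameter of a partition and not with its
  index \<open>h\<close>: every \<open>h > 0\<close> is an index, and for \<open>h\<close> exceeding the diameter of the domain no element
  contains a ball of radius comparable to \<open>h\<close>.  The intersection with the affine hull is only
  relevant for the surface elements.
\<close>

definition quasiuniform :: "(real \<Rightarrow> 'a::euclidean_space set set) \<Rightarrow> bool" where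
  "quasiuniform T \<longleftrightarrow>
     (\<exists>\<kappa>>0. \<forall>h>0. \<forall>K\<in>T h. \<forall>L\<in>T h. \<exists>x\<in>K. ball x (\<kappa> * diameter L) \<inter> affine hull K \<subseteq> K)"

definition bulk_surface_partitions ::
    "'a::euclidean_space set \<Rightarrow> (real \<Rightarrow> 'a set set) \<Rightarrow> (real \<Rightarrow> 'a set set) \<Rightarrow> bool" where
  "bulk_surface_partitions \<Omega> T T\<^sub>\<Gamma> \<longleftrightarrow>
     quasiuniform T \<and> quasiuniform T\<^sub>\<Gamma> \<and>
     (\<forall>h>0.
        simplicial_partition DIM('a) (closure \<Omega>) (T h) \<and>
        triangulation (closure ` T h) \<and>
        (\<forall>K\<in>T h. diameter K \<le> h) \<and>
        simplicial_partition (DIM('a) - 1) (frontier \<Omega>) (T\<^sub>\<Gamma> h) \<and>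
        (\<forall>K\<in>T\<^sub>\<Gamma> h. diameter K \<le> h) \<and>
        (\<forall>K\<^sub>\<Gamma>\<in>T\<^sub>\<Gamma> h. \<exists>!K. K \<in> T h \<and> closure K\<^sub>\<Gamma> = closure K \<inter> frontier \<Omega>))"


section \<open>Finite element spaces and nodal interpolation\<close>

text \<open>
  Functions on \<open>D\<close> are represented by total functions whose values outside \<open>D\<close> are irrelevant, so
  that the trace of a function on \<open>closure \<Omega>\<close> is the function itself.
\<close>

definition pw_linear :: "'a::euclidean_space set \<Rightarrow> 'a set set \<Rightarrow> ('a \<Rightarrow> real) set" where
  "pw_linear D T = {u. continuous_on D u \<and> (\<forall>K\<in>T. \<exists>a b. \<forall>x\<in>K. u x = a \<bullet> x + b)}"

definition U_bulk :: "'a::euclidean_space set \<Rightarrow> 'a set set \<Rightarrow> ('a \<Rightarrow> real) set" where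
  "U_bulk \<Omega> T = pw_linear (closure \<Omega>) T"

definition U_surf :: "'a::euclidean_space set \<Rightarrow> 'a set set \<Rightarrow> ('a \<Rightarrow> real) set" where
  "U_surf \<Omega> T\<^sub>\<Gamma> = pw_linear (frontier \<Omega>) T\<^sub>\<Gamma>"

definition nodes :: "'a::euclidean_space set set \<Rightarrow> 'a set" where
  "nodes T = {p. \<exists>K\<in>T. p extreme_point_of closure K}"

text \<open>
  The interpolant is unique as a function on \<open>D\<close>; the choice only concerns irrelevant values
  outside \<open>D\<close>.
\<close>

definition nodal_interp ::
    "'a::euclidean_space set \<Rightarrow> 'a set set \<Rightarrow> ('a \<Rightarrow> real) \<Rightarrow> 'a \<Rightarrow> real" where
  "nodal_interp D T g = (SOME u. u \<in> pw_linear D T \<and> (\<forall>p\<in>nodes T. u p = g p))"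

definition interp_bulk ::
    "'a::euclidean_space set \<Rightarrow> 'a set set \<Rightarrow> ('a \<Rightarrow> real) \<Rightarrow> 'a \<Rightarrow> real" where
  "interp_bulk \<Omega> T g = nodal_interp (closure \<Omega>) T g"

definition interp_surf ::
    "'a::euclidean_space set \<Rightarrow> 'a set set \<Rightarrow> ('a \<Rightarrow> real) \<Rightarrow> 'a \<Rightarrow> real" where
  "interp_surf \<Omega> T\<^sub>\<Gamma> g = nodal_interp (frontier \<Omega>) T\<^sub>\<Gamma> g"


section \<open>Integrals and energies\<close>

definition int_bulk :: "'a::euclidean_space set \<Rightarrow> ('a \<Rightarrow> real) \<Rightarrow> real" where
  "int_bulk \<Omega> f = (LINT x:\<Omega>|lebesgue. f x)"

definition int_surf :: "'a::euclidean_space set \<Rightarrow> ('a \<Rightarrow> real) \<Rightarrow> real" where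
  "int_surf \<Omega> f = (LINT x:frontier \<Omega>|surface_measure. f x)"

definition E_bulk ::
    "'a::euclidean_space set \<Rightarrow> 'a set set \<Rightarrow> (real \<Rightarrow> real) \<Rightarrow> ('a \<Rightarrow> real) \<Rightarrow> real" where
  "E_bulk \<Omega> T F \<zeta> = int_bulk \<Omega> (interp_bulk \<Omega> T (\<lambda>x. F (\<zeta> x)))"

definition E_surf ::
    "'a::euclidean_space set \<Rightarrow> 'a set set \<Rightarrow> (real \<Rightarrow> real) \<Rightarrow> ('a \<Rightarrow> real) \<Rightarrow> real" where
  "E_surf \<Omega> T\<^sub>\<Gamma> G \<zeta> = int_surf \<Omega> (interp_surf \<Omega> T\<^sub>\<Gamma> (\<lambda>x. G (\<zeta> x)))"


section \<open>Potentials\<close>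

definition C2_real :: "(real \<Rightarrow> real) \<Rightarrow> bool" where
  "C2_real f \<longleftrightarrow> f C1_differentiable_on UNIV \<and> deriv f C1_differentiable_on UNIV"

definition C11_real :: "(real \<Rightarrow> real) \<Rightarrow> bool" where
  "C11_real f \<longleftrightarrow> f C1_differentiable_on UNIV \<and> (\<exists>L. L-lipschitz_on UNIV (deriv f))"

definition growth_conditions :: "(real \<Rightarrow> real) \<Rightarrow> bool" where
  "growth_conditions F \<longleftrightarrow>
     (\<exists>C. \<forall>\<zeta>. \<bar>F \<zeta>\<bar> \<le> C * (1 + \<bar>\<zeta>\<bar> ^ 4) \<and> \<bar>deriv F \<zeta>\<bar> \<le> C * (1 + \<bar>\<zeta>\<bar> ^ 3))"

definition splitting_condition :: "(real \<Rightarrow> real) \<Rightarrow> bool" where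
  "splitting_condition F \<longleftrightarrow>
     (\<exists>F\<^sub>1 F\<^sub>2. (\<forall>\<zeta>. F \<zeta> = F\<^sub>1 \<zeta> + F\<^sub>2 \<zeta>) \<and> C11_real F\<^sub>1 \<and> C2_real F\<^sub>2 \<and>
        (\<exists>C. \<forall>\<zeta>. \<bar>deriv (deriv F\<^sub>2) \<zeta>\<bar> \<le> C * (1 + \<bar>\<zeta>\<bar> ^ 2)))"

definition admissible_potentials ::
    "'a::euclidean_space set \<Rightarrow> (real \<Rightarrow> 'a set set) \<Rightarrow> (real \<Rightarrow> 'a set set) \<Rightarrow>
     (real \<Rightarrow> real) \<Rightarrow> (real \<Rightarrow> real) \<Rightarrow> bool" where
  "admissible_potentials \<Omega> T T\<^sub>\<Gamma> F G \<longleftrightarrow>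
     F C1_differentiable_on UNIV \<and> G C1_differentiable_on UNIV \<and>
     (\<exists>\<gamma>>0. \<forall>h>0. (\<forall>\<zeta>\<in>U_bulk \<Omega> (T h). E_bulk \<Omega> (T h) F \<zeta> \<ge> \<gamma>) \<and>
                   (\<forall>\<zeta>\<in>U_surf \<Omega> (T\<^sub>\<Gamma> h). E_surf \<Omega> (T\<^sub>\<Gamma> h) G \<zeta> \<ge> \<gamma>)) \<and>
     growth_conditions F \<and> growth_conditions G \<and>
     splitting_condition F \<and> splitting_condition G"


section \<open>The discrete scheme\<close>

definition bdq :: "real \<Rightarrow> (nat \<Rightarrow> 'a \<Rightarrow> real) \<Rightarrow> nat \<Rightarrow> 'a \<Rightarrow> real" where
  "bdq \<tau> a n x = (a n x - a (n - 1) x) / \<tau>"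

text \<open>The coefficients \<open>1 / (1 + \<xi>)\<close> and \<open>\<xi> / (1 + \<xi>)\<close> for \<open>\<xi> \<in> [0, \<infinity>]\<close>.\<close>

definition coeff_rate :: "ennreal \<Rightarrow> real" where
  "coeff_rate \<xi> = (if \<xi> = \<infinity> then 0 else 1 / (1 + enn2real \<xi>))"

definition coeff_exchange :: "ennreal \<Rightarrow> real" where
  "coeff_exchange \<xi> = (if \<xi> = \<infinity> then 1 else enn2real \<xi> / (1 + enn2real \<xi>))"

definition scheme_step ::
    "'a::euclidean_space set \<Rightarrow> 'a set set \<Rightarrow> 'a set set \<Rightarrow> real \<Rightarrow> real \<Rightarrow>
     (real \<Rightarrow> real) \<Rightarrow> (real \<Rightarrow> real) \<Rightarrow> ennreal \<Rightarrow> nat \<Rightarrow>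
     (nat \<Rightarrow> 'a \<Rightarrow> real) \<Rightarrow> (nat \<Rightarrow> 'a \<Rightarrow> real) \<Rightarrow> (nat \<Rightarrow> 'a \<Rightarrow> real) \<Rightarrow>
     (nat \<Rightarrow> real) \<Rightarrow> (nat \<Rightarrow> real) \<Rightarrow> bool" where
  "scheme_step \<Omega> T T\<^sub>\<Gamma> \<beta> \<tau> F G \<xi> n \<phi> \<mu> \<theta> r s \<longleftrightarrow>
    \<phi> n \<in> U_bulk \<Omega> T \<and> \<mu> n \<in> U_bulk \<Omega> T \<and> \<theta> n \<in> U_surf \<Omega> T\<^sub>\<Gamma> \<and>
    (\<forall>\<psi>\<in>U_bulk \<Omega> T.
        int_bulk \<Omega> (interp_bulk \<Omega> T (\<lambda>x. bdq \<tau> \<phi> n x * \<psi> x))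
      + int_bulk \<Omega> (\<lambda>x. grad (\<mu> n) x \<bullet> grad \<psi> x)
      + 1 / \<beta> * int_surf \<Omega> (interp_surf \<Omega> T\<^sub>\<Gamma> (\<lambda>x. bdq \<tau> \<phi> n x * \<psi> x))
      + 1 / \<beta> * int_surf \<Omega> (\<lambda>x. surface_grad (frontier \<Omega>) (\<theta> n) x
                                   \<bullet> surface_grad (frontier \<Omega>) \<psi> x) = 0) \<and>
    (\<forall>\<eta>\<in>U_surf \<Omega> T\<^sub>\<Gamma>.
        coeff_rate \<xi> * int_surf \<Omega> (interp_surf \<Omega> T\<^sub>\<Gamma> (\<lambda>x. bdq \<tau> \<phi> n x * \<eta> x))
      + coeff_rate \<xi> * int_surf \<Omega> (\<lambda>x. surface_grad (frontier \<Omega>) (\<theta> n) x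
                                         \<bullet> surface_grad (frontier \<Omega>) \<eta> x)
      + coeff_exchange \<xi> * \<beta> *
          int_surf \<Omega> (interp_surf \<Omega> T\<^sub>\<Gamma> (\<lambda>x. (\<beta> * \<theta> n x - \<mu> n x) * \<eta> x)) = 0) \<and>
    (\<forall>\<psi>\<in>U_bulk \<Omega> T.
        int_bulk \<Omega> (interp_bulk \<Omega> T (\<lambda>x. \<mu> n x * \<psi> x))
      + int_surf \<Omega> (interp_surf \<Omega> T\<^sub>\<Gamma> (\<lambda>x. \<theta> n x * \<psi> x))
      = int_bulk \<Omega> (\<lambda>x. grad (\<phi> n) x \<bullet> grad \<psi> x)
      + int_surf \<Omega> (\<lambda>x. surface_grad (frontier \<Omega>) (\<phi> n) x \<bullet> surface_grad (frontier \<Omega>) \<psi> x)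
      + r n / sqrt (E_bulk \<Omega> T F (\<phi> (n - 1))) *
          int_bulk \<Omega> (interp_bulk \<Omega> T (\<lambda>x. deriv F (\<phi> (n - 1) x) * \<psi> x))
      + s n / sqrt (E_surf \<Omega> T\<^sub>\<Gamma> G (\<phi> (n - 1))) *
          int_surf \<Omega> (interp_surf \<Omega> T\<^sub>\<Gamma> (\<lambda>x. deriv G (\<phi> (n - 1) x) * \<psi> x))) \<and>
    r n = r (n - 1) + 1 / (2 * sqrt (E_bulk \<Omega> T F (\<phi> (n - 1)))) *
      int_bulk \<Omega> (interp_bulk \<Omega> T (\<lambda>x. deriv F (\<phi> (n - 1) x) * (\<phi> n x - \<phi> (n - 1) x))) \<and>
    s n = s (n - 1) + 1 / (2 * sqrt (E_surf \<Omega> T\<^sub>\<Gamma> G (\<phi> (n - 1)))) *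
      int_surf \<Omega> (interp_surf \<Omega> T\<^sub>\<Gamma> (\<lambda>x. deriv G (\<phi> (n - 1) x) * (\<phi> n x - \<phi> (n - 1) x)))"

end

theory Submission
  imports Defs
begin

text \<open>
  Testing the first equation with \<open>\<mu>\<close>, the second with \<open>\<beta> \<theta> - \<mu>\<close> and the third with the increment
  of \<open>\<phi>\<close> makes the lumped terms cancel; the scalar updates turn the potential terms into
  \<open>2 r (r - r')\<close> and \<open>2 s (s - s')\<close>, and \<open>2 x (x - y) = x\<^sup>2 - y\<^sup>2 + (x - y)\<^sup>2\<close> finishes the
  computation.  What this needs is that lumped integrals and Dirichlet forms really are bilinear: nodal
  interpolants exist and are unique because elements meet in common faces (on the boundary this follows
  from convexity of the domain), and gradients are constant off a skeleton which is null for Lebesgue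
  resp. Hausdorff measure, the surface having finite Hausdorff measure.  For \<open>\<xi> = \<infinity>\<close> the second equation
  gives that the interpolant of \<open>(\<beta> \<theta> - \<mu>)\<^sup>2\<close> has integral zero; as every boundary element has positive
  measure, \<open>\<beta> \<theta> - \<mu>\<close> vanishes at all nodes.
\<close>

section \<open>Nodal interpolation on conforming simplicial partitions\<close>

text \<open>The obstacle is that the scheme is written with total functions and choice operators. A
  representative of a discrete function is arbitrary off its domain, interpolants are
  \<open>SOME\<close>-terms, and \<open>grad\<close> and \<open>surface_grad\<close> are
  \<open>THE\<close>-terms that may be meaningless on the skeleton. No linearity comes for free, so
  identities for gradients are proved on the open elements, where the slope determines everything,
  and enter the integrals only almost everywhere. Bulk and boundary need the same calculus; it is
  developed once for an abstract set, measure and gradient operator. On the boundary the Hausdorff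
  measure is never identified with Lebesgue measure on hyperplanes. Three qualitative facts suffice:
  a facet has finite measure (a grid count), its relative boundary is null, and its measure is
  positive (a null facet would thicken to a negligible convex body). At \<xi> = \<infinity> the rate
  coefficient of the second equation vanishes, and with it the relation that cancels the mixed terms
  of the first. It is recovered afterwards from the equality of \<beta> \<theta> and \<mu> on the
  boundary.\<close>

lemma affine_interpolation_exists:
  fixes V :: "'a::euclidean_space set" and g :: "'a \<Rightarrow> real"
  assumes "\<not> affine_dependent V"
  shows "\<exists>a b. \<forall>v\<in>V. a \<bullet> v + b = g v"
proof (cases "V = {}")
  case False
  then obtain v0 where v0: "v0 \<in> V" by auto
  have ind: "independent ((\<lambda>x. -v0 + x) ` (V - {v0}))"
    using assms affine_dependent_iff_dependent2[OF v0] by simp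
  obtain f :: "'a \<Rightarrow> real" where f: "linear f"
    and fv: "\<And>x. x \<in> (\<lambda>x. -v0 + x) ` (V - {v0}) \<Longrightarrow> f x = g (v0 + x) - g v0"
    using linear_independent_extend[OF ind, of "\<lambda>x. g (v0 + x) - g v0"] by blast
  \<comment> \<open>Slopes are encoded as inner products; \<open>adjoint f 1\<close> is the Riesz
    vector of the functional \<open>f\<close>.\<close>
  have rep: "adjoint f 1 \<bullet> x = f x" for x
    using adjoint_works[OF f, of x 1] by (simp add: inner_commute)
  have "adjoint f 1 \<bullet> v + (g v0 - f v0) = g v" if "v \<in> V" for v
  proof (cases "v = v0")
    case False
    then have "f (-v0 + v) = g v - g v0" using fv[of "-v0 + v"] that by auto
    moreover have "f (-v0 + v) = f v - f v0"
      using f by (simp add: linear_diff)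
    ultimately show ?thesis by (simp add: rep)
  qed (simp add: rep)
  then show ?thesis by blast
qed simp

text \<open>The set where two affine functions agree is the solution set of one linear equation,
  hence convex.\<close>

lemma affine_eq_on_convex_hull:
  fixes V :: "'a::real_inner set"
  assumes "\<And>v. v \<in> V \<Longrightarrow> a \<bullet> v + b = a' \<bullet> v + b'" and "x \<in> convex hull V"
  shows "a \<bullet> x + b = a' \<bullet> x + b'"
proof -
  have "V \<subseteq> {x. (a - a') \<bullet> x = b' - b}"
    using assms(1) by (fastforce simp: inner_diff_left)
  then have "convex hull V \<subseteq> {x. (a - a') \<bullet> x = b' - b}"
    by (intro hull_minimal convex_hyperplane)
  then show ?thesis using assms(2) by (auto simp: inner_diff_left algebra_simps)
qed

lemma open_simplexE:
  fixes K :: "'a::euclidean_space set"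
  assumes "open_simplex k K"
  obtains V where "finite V" "\<not> affine_dependent V" "card V = k + 1"
    "closure K = convex hull V" "K = rel_interior (convex hull V)"
    "\<And>p. p extreme_point_of closure K \<longleftrightarrow> p \<in> V"
proof -
  obtain S where S: "int k simplex S" "K = rel_interior S"
    using assms by (auto simp: open_simplex_def)
  then obtain V where V: "finite V" "\<not> affine_dependent V" "int (card V) = int k + 1"
    "S = convex hull V"
    by (auto simp: simplex)
  have "closure K = convex hull V"
    using S V by (simp add: convex_closure_rel_interior finite_imp_compact_convex_hull compact_imp_closed)
  then show ?thesis
    using that[of V] S V extreme_point_of_convex_hull_affine_independent[OF V(2)] by simp
qed

lemma open_simplex_props:
  fixes K :: "'a::euclidean_space set"
  assumes "open_simplex k K"
  shows "convex K" "compact (closure K)" "convex (closure K)" "aff_dim K = int k"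
    "K = rel_interior (closure K)" "aff_dim (closure K) = int k"
    "K \<in> sets borel"
proof -
  obtain V where V: "finite V" "\<not> affine_dependent V" "card V = k + 1"
    "closure K = convex hull V" "K = rel_interior (convex hull V)"
    by (rule open_simplexE[OF assms]) blast
  show "compact (closure K)" "convex (closure K)"
    using V by (simp_all add: finite_imp_compact_convex_hull)
  show "K = rel_interior (closure K)" using V by simp
  show "convex K" using V by (simp add: convex_rel_interior)
  show "aff_dim (closure K) = int k"
    using V aff_dim_affine_independent[OF V(2)] by (simp add: aff_dim_convex_hull)
  then show "aff_dim K = int k" by (simp add: closure_aff_dim)
  have "openin (top_of_set (affine hull (convex hull V))) K"
    unfolding V(5) by (rule openin_rel_interior)
  then obtain U where "open U" "K = affine hull (convex hull V) \<inter> U"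
    by (auto simp: openin_open)
  then show "K \<in> sets borel" by simp
qed

text \<open>The face condition is imposed on ordered pairs, so exchanging \<open>K\<close> and
  \<open>L\<close> makes the intersection a face of both. The dimension \<open>k\<close> is free in
  order to cover bulk simplices and boundary facets alike.\<close>

locale conforming_partition =
  fixes k :: nat and D :: "'a::euclidean_space set" and T :: "'a set set"
  assumes simplicial: "simplicial_partition k D T"
    and conforming: "\<And>K L. K \<in> T \<Longrightarrow> L \<in> T \<Longrightarrow> closure K \<inter> closure L face_of closure K"
begin

lemma finite_T: "finite T"
  and open_simplex: "K \<in> T \<Longrightarrow> open_simplex k K"
  and disjoint: "K \<in> T \<Longrightarrow> L \<in> T \<Longrightarrow> K \<noteq> L \<Longrightarrow> K \<inter> L = {}"
  and D_eq: "D = (\<Union>K\<in>T. closure K)"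
  using simplicial by (auto simp: simplicial_partition_def pairwise_def disjnt_def)

lemmas simplex_props = open_simplex_props[OF open_simplex]

lemma compact_D: "compact D"
  unfolding D_eq using finite_T simplex_props(2) by (intro compact_UN) auto

lemma closure_subset_D: "K \<in> T \<Longrightarrow> closure K \<subseteq> D"
  by (auto simp: D_eq)

lemma pw_linear_continuous: "u \<in> pw_linear D T \<Longrightarrow> continuous_on D u"
  by (simp add: pw_linear_def)

text \<open>Membership in \<open>pw_linear\<close> gives a slope on the open simplex only. Minus its
  linear part the function is constant there, and continuity carries the constant to the
  closure.\<close>

lemma pw_linear_affine_closure:
  assumes "u \<in> pw_linear D T" "K \<in> T"
  obtains a b where "\<And>x. x \<in> closure K \<Longrightarrow> u x = a \<bullet> x + b"
proof -
  obtain a b where ab: "\<And>x. x \<in> K \<Longrightarrow> u x = a \<bullet> x + b"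
    using assms by (auto simp: pw_linear_def)
  have "continuous_on (closure K) (\<lambda>x. u x - a \<bullet> x)"
    using assms closure_subset_D pw_linear_continuous
    by (intro continuous_intros) (blast intro: continuous_on_subset)
  then have "u x - a \<bullet> x = b" if "x \<in> closure K" for x
    by (rule continuous_constant_on_closure[OF _ _ that]) (simp add: ab)
  then show ?thesis by (intro that[of a b]) (metis add.commute diff_eq_eq)
qed

lemma pw_linear_combination:
  assumes "u \<in> pw_linear D T" "v \<in> pw_linear D T"
  shows "(\<lambda>x. \<alpha> * u x + \<beta> * v x) \<in> pw_linear D T"
  unfolding pw_linear_def
proof (intro CollectI conjI ballI)
  show "continuous_on D (\<lambda>x. \<alpha> * u x + \<beta> * v x)"
    using assms by (intro continuous_intros pw_linear_continuous)
  fix K assume "K \<in> T"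
  then obtain a b a' b' where "\<forall>x\<in>K. u x = a \<bullet> x + b" "\<forall>x\<in>K. v x = a' \<bullet> x + b'"
    using assms by (fastforce simp: pw_linear_def)
  then show "\<exists>a b. \<forall>x\<in>K. \<alpha> * u x + \<beta> * v x = a \<bullet> x + b"
    by (intro exI[of _ "\<alpha> *\<^sub>R a + \<beta> *\<^sub>R a'"] exI[of _ "\<alpha> * b + \<beta> * b'"])
      (auto simp: algebra_simps)
qed

lemma nodes_subset: "nodes T \<subseteq> D"
  using closure_subset_D by (auto simp: nodes_def extreme_point_of_def)

text \<open>Affine functions commute with convex combinations. Uniqueness, nonnegativity and the
  detection of zeros of interpolants are all read off this barycentric formula.\<close>

lemma vertex_combination:
  assumes "u \<in> pw_linear D T" "K \<in> T" "finite V" "closure K = convex hull V"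
    and x: "(\<forall>v\<in>V. 0 \<le> c v) \<and> sum c V = 1 \<and> (\<Sum>v\<in>V. c v *\<^sub>R v) = x"
  shows "u x = (\<Sum>v\<in>V. c v * u v)"
proof -
  obtain a b where ab: "\<And>x. x \<in> closure K \<Longrightarrow> u x = a \<bullet> x + b"
    using pw_linear_affine_closure[OF assms(1,2)] by blast
  have "x \<in> closure K"
    using x unfolding assms(4) convex_hull_finite[OF assms(3)] by blast
  then have "u x = a \<bullet> (\<Sum>v\<in>V. c v *\<^sub>R v) + b * sum c V"
    using ab x by simp
  also have "\<dots> = (\<Sum>v\<in>V. c v * (a \<bullet> v + b))"
    by (simp add: inner_sum_right sum_distrib_left sum.distrib algebra_simps)
  also have "\<dots> = (\<Sum>v\<in>V. c v * u v)"
    using ab assms(4) hull_subset[of V convex] by (intro sum.cong) auto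
  finally show ?thesis .
qed

lemma pw_linear_eqI:
  assumes "u \<in> pw_linear D T" "v \<in> pw_linear D T"
    and nodes: "\<And>p. p \<in> nodes T \<Longrightarrow> u p = v p" and x: "x \<in> D"
  shows "u x = v x"
proof -
  obtain K where K: "K \<in> T" "x \<in> closure K" using x by (auto simp: D_eq)
  obtain V where V: "finite V" "closure K = convex hull V" "\<And>p. p extreme_point_of closure K \<longleftrightarrow> p \<in> V"
    by (rule open_simplexE[OF open_simplex[OF K(1)]]) blast
  obtain c where c: "(\<forall>v\<in>V. 0 \<le> c v) \<and> sum c V = 1 \<and> (\<Sum>v\<in>V. c v *\<^sub>R v) = x"
    using K(2) unfolding V(2) convex_hull_finite[OF V(1)] by blast
  have "p \<in> nodes T" if "p \<in> V" for p using that V(3) K(1) by (auto simp: nodes_def)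
  then show ?thesis
    unfolding vertex_combination[OF assms(1) K(1) V(1,2) c]
      vertex_combination[OF assms(2) K(1) V(1,2) c]
    using nodes by simp
qed

text \<open>Every element has its own affine interpolant. The intersection of two closed elements is
  spanned by vertices of the first; being a face of both, it makes these vertices extreme in the
  second too. Both interpolants thus take the nodal values there and agree on the hull, and finitely
  many closed pieces glue to a continuous function.\<close>

lemma nodal_interpolant_exists: "\<exists>u\<in>pw_linear D T. \<forall>p\<in>nodes T. u p = g p"
proof -
  have "\<exists>a b. \<forall>p. p extreme_point_of closure K \<longrightarrow> a \<bullet> p + b = g p" if K: "K \<in> T" for K
  proof -
    obtain V where V: "\<not> affine_dependent V" "\<And>p. p extreme_point_of closure K \<longleftrightarrow> p \<in> V"
      by (rule open_simplexE[OF open_simplex[OF K]]) blast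
    then show ?thesis using affine_interpolation_exists[OF V(1), of g] by auto
  qed
  then obtain a b where ab:
    "\<And>K p. K \<in> T \<Longrightarrow> p extreme_point_of closure K \<Longrightarrow> a K \<bullet> p + b K = g p"
    by metis
  have agree: "a K \<bullet> x + b K = a L \<bullet> x + b L"
    if KL: "K \<in> T" "L \<in> T" "x \<in> closure K" "x \<in> closure L" for K L x
  proof -
    obtain V where V: "\<not> affine_dependent V" "closure K = convex hull V"
      "\<And>p. p extreme_point_of closure K \<longleftrightarrow> p \<in> V"
      by (rule open_simplexE[OF open_simplex[OF KL(1)]]) blast
    have FK: "closure K \<inter> closure L face_of closure K"
      and FL: "closure K \<inter> closure L face_of closure L"
      using conforming[OF KL(1,2)] conforming[OF KL(2,1)] by (simp_all add: Int_commute)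
    obtain c where c: "c \<subseteq> V" "closure K \<inter> closure L = convex hull c"
      using FK unfolding V(2) face_of_convex_hull_affine_independent[OF V(1)] by blast
    show ?thesis
    proof (rule affine_eq_on_convex_hull)
      show "x \<in> convex hull c" using KL c by blast
      fix v assume v: "v \<in> c"
      then have "v \<in> closure K \<inter> closure L" using c(2) hull_subset[of c convex] by blast
      moreover have "v extreme_point_of closure K" using v c V by blast
      ultimately have "v extreme_point_of closure L"
        using extreme_point_of_face[OF FK] extreme_point_of_face[OF FL] by blast
      then show "a K \<bullet> v + b K = a L \<bullet> v + b L"
        using ab[OF KL(1) \<open>v extreme_point_of closure K\<close>] ab[OF KL(2)] by simp
    qed
  qed
  define el where "el x = (SOME K. K \<in> T \<and> x \<in> closure K)" for x
  define u where "u x = a (el x) \<bullet> x + b (el x)" for x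
  have u: "u x = a K \<bullet> x + b K" if "K \<in> T" "x \<in> closure K" for K x
    unfolding u_def using someI[of "\<lambda>K. K \<in> T \<and> x \<in> closure K" K] that
    by (intro agree) (auto simp: el_def)
  have "continuous_on D u"
    unfolding D_eq
  proof (rule continuous_on_closed_Union[OF finite_T])
    fix K assume K: "K \<in> T"
    have "continuous_on (closure K) (\<lambda>x. a K \<bullet> x + b K)" by (intro continuous_intros)
    then show "continuous_on (closure K) u" using u[OF K] by (simp cong: continuous_on_cong)
  qed auto
  moreover have "\<exists>a b. \<forall>x\<in>K. u x = a \<bullet> x + b" if "K \<in> T" for K
    using u[OF that] closure_subset by blast
  moreover have "u p = g p" if "p \<in> nodes T" for p
    using that ab u by (auto simp: nodes_def extreme_point_of_def)
  ultimately show ?thesis by (auto simp: pw_linear_def)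
qed

lemma nodal_interp_pw_linear: "nodal_interp D T g \<in> pw_linear D T"
  and nodal_interp_nodes: "p \<in> nodes T \<Longrightarrow> nodal_interp D T g p = g p"
  using someI_ex[OF nodal_interpolant_exists[of g, unfolded Bex_def]]
  by (auto simp: nodal_interp_def)

section \<open>Linearity, locality and positivity of the interpolation operator\<close>

lemma nodal_interp_combination:
  assumes "x \<in> D"
  shows "nodal_interp D T (\<lambda>x. \<alpha> * f x + \<beta> * g x) x
    = \<alpha> * nodal_interp D T f x + \<beta> * nodal_interp D T g x"
  by (rule pw_linear_eqI[OF _ _ _ assms])
    (auto intro: nodal_interp_pw_linear pw_linear_combination simp: nodal_interp_nodes)

text \<open>An equality of total functions, also off \<open>D\<close>: only nodal values enter the
  predicate under \<open>SOME\<close>, and the nodes lie in \<open>D\<close>, so both sides choose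
  by the same predicate.\<close>

lemma nodal_interp_cong:
  assumes "\<And>p. p \<in> D \<Longrightarrow> f p = g p"
  shows "nodal_interp D T f = nodal_interp D T g"
proof -
  have "(\<forall>p\<in>nodes T. u p = f p) \<longleftrightarrow> (\<forall>p\<in>nodes T. u p = g p)" for u
    using assms nodes_subset by auto
  then show ?thesis by (simp add: nodal_interp_def)
qed

lemma nodal_interp_nonneg:
  assumes "\<And>p. p \<in> nodes T \<Longrightarrow> 0 \<le> g p" "x \<in> D"
  shows "0 \<le> nodal_interp D T g x"
proof -
  obtain K where K: "K \<in> T" "x \<in> closure K" using assms(2) by (auto simp: D_eq)
  obtain V where V: "finite V" "closure K = convex hull V" "\<And>p. p extreme_point_of closure K \<longleftrightarrow> p \<in> V"
    by (rule open_simplexE[OF open_simplex[OF K(1)]]) blast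
  obtain c where c: "(\<forall>v\<in>V. 0 \<le> c v) \<and> sum c V = 1 \<and> (\<Sum>v\<in>V. c v *\<^sub>R v) = x"
    using K(2) unfolding V(2) convex_hull_finite[OF V(1)] by blast
  have "p \<in> nodes T" if "p \<in> V" for p using that V(3) K(1) by (auto simp: nodes_def)
  then show ?thesis
    unfolding vertex_combination[OF nodal_interp_pw_linear K(1) V(1,2) c]
    using c assms(1) by (intro sum_nonneg mult_nonneg_nonneg) (auto simp: nodal_interp_nodes)
qed

text \<open>In the open simplex all barycentric coordinates are positive.\<close>

lemma nodal_interp_zero_imp_vertices_zero:
  assumes nonneg: "\<And>p. p \<in> nodes T \<Longrightarrow> 0 \<le> g p" and K: "K \<in> T" and x: "x \<in> K"
    and zero: "nodal_interp D T g x = 0" and p: "p extreme_point_of closure K"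
  shows "g p = 0"
proof -
  obtain V where V: "finite V" "\<not> affine_dependent V" "closure K = convex hull V"
     "K = rel_interior (convex hull V)" "\<And>p. p extreme_point_of closure K \<longleftrightarrow> p \<in> V"
    by (rule open_simplexE[OF open_simplex[OF K(1)]]) blast
  obtain c where c: "\<forall>v\<in>V. 0 < c v" "sum c V = 1" "(\<Sum>v\<in>V. c v *\<^sub>R v) = x"
    using x unfolding V(4) rel_interior_convex_hull_explicit[OF V(2)] by auto
  have c': "(\<forall>v\<in>V. 0 \<le> c v) \<and> sum c V = 1 \<and> (\<Sum>v\<in>V. c v *\<^sub>R v) = x"
    using c by (auto intro: less_imp_le)
  have nd: "p \<in> nodes T" if "p \<in> V" for p using that V(5) K(1) by (auto simp: nodes_def)
  have "(\<Sum>v\<in>V. c v * nodal_interp D T g v) = 0"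
    using vertex_combination[OF nodal_interp_pw_linear K V(1,3) c'] zero by simp
  then have "c p * nodal_interp D T g p = 0"
    using V(1,5) p c' nonneg nd nodal_interp_nodes
    by (subst (asm) sum_nonneg_eq_0_iff) auto
  then show ?thesis using c(1) p V(5) nd nodal_interp_nodes by auto
qed

end

section \<open>Lumped integrals and Dirichlet forms\<close>

text \<open>Preimages under \<open>f\<close> and \<open>g\<close> differ only by parts of the null
  set where \<open>f\<close> and \<open>g\<close> disagree, and the completion makes every such part
  measurable. This serves gradients, which are known only off the skeleton.\<close>

lemma borel_measurable_completion_AE_eq:
  fixes f g :: "'a \<Rightarrow> 'b::{second_countable_topology, t2_space}"
  assumes g: "g \<in> borel_measurable M" and ae: "AE x in M. f x = g x"
  shows "f \<in> borel_measurable (completion M)"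
proof (rule measurableI)
  fix A :: "'b set" assume A: "A \<in> sets borel"
  have 1: "{x\<in>space M. P x \<and> f x \<noteq> g x} \<in> sets (completion M)" for P
  proof -
    have "AE x in M. \<not> (P x \<and> f x \<noteq> g x)" using ae by (rule AE_mp) simp
    then show ?thesis
      using sets_completion_AE[where M=M and P="\<lambda>x. P x \<and> f x \<noteq> g x"] by (simp add: pred_def)
  qed
  have "f -` A \<inter> space (completion M) =
      (g -` A \<inter> space M - {x\<in>space M. g x \<in> A \<and> f x \<noteq> g x}) \<union> {x\<in>space M. f x \<in> A \<and> f x \<noteq> g x}"
    by auto
  also have "\<dots> \<in> sets (completion M)"
    by (intro sets.Un sets.Diff 1 sets_completionI_sets measurable_sets[OF g A])
  finally show "f -` A \<inter> space (completion M) \<in> sets (completion M)" .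
qed auto

text \<open>
  \<open>grd\<close> is any operator that acts linearly on the slope of an affine function, element by element;
  this covers both the gradient in the domain and the surface gradient on its boundary.
\<close>

locale finite_element_space = conforming_partition k D T
  for k and D :: "'a::euclidean_space set" and T +
  fixes M :: "'a measure" and E :: "'a set" and grd :: "('a \<Rightarrow> real) \<Rightarrow> 'a \<Rightarrow> 'a"
  assumes sets_M: "sets M = sets borel"
    and E_sets: "E \<in> sets borel" and E_subset: "E \<subseteq> D" and E_finite: "emeasure M E < \<infinity>"
    and skeleton_null: "AE x in M. x \<in> E \<longrightarrow> x \<in> \<Union>T"
    and grd_element: "\<And>K. K \<in> T \<Longrightarrow> \<exists>P. linear P \<and>
      (\<forall>u a b x. (\<forall>y\<in>K. u y = a \<bullet> y + b) \<longrightarrow> x \<in> K \<longrightarrow> grd u x = P a)"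
begin

text \<open>The completion turns \<open>lborel\<close> into \<open>lebesgue\<close> and the
  Hausdorff measure into \<open>surface_measure\<close>, so this one definition matches
  \<open>int_bulk\<close> and \<open>int_surf\<close>.\<close>

definition integ :: "('a \<Rightarrow> real) \<Rightarrow> real" where
  "integ f = (LINT x:E|completion M. f x)"

definition lumped :: "('a \<Rightarrow> real) \<Rightarrow> real" where
  "lumped g = integ (nodal_interp D T g)"

definition dirichlet :: "('a \<Rightarrow> real) \<Rightarrow> ('a \<Rightarrow> real) \<Rightarrow> real" where
  "dirichlet u v = integ (\<lambda>x. grd u x \<bullet> grd v x)"

lemma space_M: "space M = UNIV"
  using sets_eq_imp_space_eq[OF sets_M] by simp

lemma pw_linear_integrable:
  assumes "u \<in> pw_linear D T"
  shows "set_integrable M E u"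
proof -
  have cont: "continuous_on E u"
    using pw_linear_continuous[OF assms] E_subset continuous_on_subset by blast
  have meas: "(\<lambda>x. indicator E x *\<^sub>R u x) \<in> borel_measurable M"
    using borel_measurable_continuous_on_indicator[OF E_sets cont]
    by (simp add: measurable_cong_sets[OF sets_M refl])
  obtain B where B: "\<And>x. x \<in> D \<Longrightarrow> norm (u x) \<le> B"
    using compact_imp_bounded[OF compact_continuous_image[OF pw_linear_continuous[OF assms] compact_D]]
    by (auto simp: bounded_iff)
  \<comment> \<open>The inner indicator provides measurability, since \<open>u\<close> itself is
    arbitrary off \<open>D\<close>; the outer one is the form of the integrability criterion for
    functions bounded on a set of finite measure.\<close>
  have "integrable M (\<lambda>x. indicator E x *\<^sub>R (indicator E x *\<^sub>R u x))"
    using E_sets E_finite meas B E_subset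
    by (intro integrableI_bounded_set_indicator[where B=B]) (auto simp: sets_M)
  then show ?thesis 
    by (simp add: set_integrable_def mult.assoc[symmetric] indicator_inter_arith[symmetric] del: indicator_simps)
qed

text \<open>Off the null skeleton \<open>h\<close> is the simple function \<open>s\<close> on
  \<open>E\<close>: the elements are disjoint, so exactly one summand survives at each covered
  point.\<close>

lemma elementwise_constant_integrable:
  fixes h :: "'a \<Rightarrow> real"
  assumes "\<And>K. K \<in> T \<Longrightarrow> \<exists>c. \<forall>x\<in>K. h x = c"
  shows "set_integrable (completion M) E h"
proof -
  obtain c where c: "\<And>K x. K \<in> T \<Longrightarrow> x \<in> K \<Longrightarrow> h x = c K" using assms by metis
  define s where "s x = (\<Sum>K\<in>T. c K * indicator (K \<inter> E) x)" for x
  have int: "integrable M s"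
    unfolding s_def
  proof (intro Bochner_Integration.integrable_sum integrable_mult_right integrable_real_indicator)
    fix K assume K: "K \<in> T"
    then show "K \<inter> E \<in> sets M" using simplex_props(7) E_sets by (auto simp: sets_M)
    then show "emeasure M (K \<inter> E) < \<infinity>"
      using E_finite E_sets emeasure_mono[of "K \<inter> E" E M] by (auto simp: sets_M)
  qed
  have eq: "indicator E x *\<^sub>R h x = s x" if cov: "x \<in> E \<longrightarrow> x \<in> \<Union>T" for x
  proof (cases "x \<in> E")
    case True
    then obtain K where K: "K \<in> T" "x \<in> K" using cov by blast
    have "s x = (\<Sum>L\<in>{K}. c L * indicator (L \<inter> E) x)"
      unfolding s_def using finite_T K disjoint[of _ K]
      by (intro sum.mono_neutral_right) (auto simp: indicator_def)
    then show ?thesis using True K c by simp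
  qed (simp add: s_def)
  have ae: "AE x in M. indicator E x *\<^sub>R h x = s x"
    using skeleton_null eq by (auto elim: AE_mp)
  have s: "s \<in> borel_measurable M" using int by simp
  have "integrable (completion M) s" using int integrable_completion[OF s] by simp
  moreover have "(\<lambda>x. indicator E x *\<^sub>R h x) \<in> borel_measurable (completion M)"
    by (rule borel_measurable_completion_AE_eq[OF s ae])
  ultimately show ?thesis
    unfolding set_integrable_def
    using AE_completion[OF ae] integrable_cong_AE[of _ "completion M" s] s measurable_completion
    by blast
qed

lemma integ_cong_elementwise:
  assumes "\<And>K x. K \<in> T \<Longrightarrow> x \<in> K \<Longrightarrow> f x = g x"
    and "\<And>K. K \<in> T \<Longrightarrow> \<exists>c. \<forall>x\<in>K. g x = c"
  shows "integ f = integ g"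
proof -
  have f: "\<exists>c. \<forall>x\<in>K. f x = c" if "K \<in> T" for K using assms that by metis
  have "AE x in M. x \<in> E \<longrightarrow> f x = g x"
    using skeleton_null assms(1) by (auto elim: AE_mp)
  then have "AE x in completion M. indicator E x *\<^sub>R f x = indicator E x *\<^sub>R g x"
    by (intro AE_completion) (auto elim: AE_mp)
  then show ?thesis
    unfolding integ_def set_lebesgue_integral_def
    using elementwise_constant_integrable[OF f] elementwise_constant_integrable[OF assms(2)]
    by (intro integral_cong_AE) (auto simp: set_integrable_def)
qed

lemma lumped_combination: "lumped (\<lambda>x. \<alpha> * f x + \<beta> * g x) = \<alpha> * lumped f + \<beta> * lumped g"
proof -
  have int: "set_integrable (completion M) E (nodal_interp D T f)" for f
    using pw_linear_integrable[OF nodal_interp_pw_linear, of f]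
    unfolding set_integrable_def by (subst integrable_completion) auto
  have "lumped (\<lambda>x. \<alpha> * f x + \<beta> * g x) =
      integ (\<lambda>x. \<alpha> * nodal_interp D T f x + \<beta> * nodal_interp D T g x)"
    unfolding lumped_def integ_def using E_subset E_sets
    by (intro set_lebesgue_integral_cong) (auto simp: nodal_interp_combination sets_M)
  then show ?thesis
    using int by (simp add: integ_def lumped_def)
qed

lemma lumped_scale: "lumped (\<lambda>x. \<alpha> * f x) = \<alpha> * lumped f"
  using lumped_combination[of \<alpha> f 0 f] by simp

lemma lumped_cong: "(\<And>x. x \<in> D \<Longrightarrow> f x = g x) \<Longrightarrow> lumped f = lumped g"
  unfolding lumped_def using nodal_interp_cong[of f g] by simp

text \<open>A nonnegative interpolant with zero integral vanishes almost everywhere on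
  \<open>E\<close>, hence somewhere in each open element, because these have positive measure. A
  single zero in the open simplex already annihilates all its vertex values.\<close>

lemma lumped_zero_imp_zero:
  assumes nonneg: "\<And>p. p \<in> nodes T \<Longrightarrow> 0 \<le> g p" and zero: "lumped g = 0"
    and pos: "\<And>K. K \<in> T \<Longrightarrow> emeasure M (K \<inter> E) > 0" and p: "p \<in> nodes T"
  shows "g p = 0"
proof -
  let ?u = "nodal_interp D T g"
  obtain K where K: "K \<in> T" "p extreme_point_of closure K" using p by (auto simp: nodes_def)
  have int: "integrable M (\<lambda>x. indicator E x *\<^sub>R ?u x)"
    using pw_linear_integrable[OF nodal_interp_pw_linear] by (simp add: set_integrable_def)
  have "integral\<^sup>L M (\<lambda>x. indicator E x *\<^sub>R ?u x) = 0"
    using zero integral_completion[of "\<lambda>x. indicator E x *\<^sub>R ?u x" M] int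
    by (simp add: lumped_def integ_def set_lebesgue_integral_def)
  moreover have "0 \<le> indicator E x *\<^sub>R ?u x" for x
    using nodal_interp_nonneg[OF nonneg] E_subset by (auto simp: indicator_def)
  ultimately have ae: "AE x in M. indicator E x *\<^sub>R ?u x = 0"
    using integral_nonneg_eq_0_iff_AE[OF int] by simp
  have "\<exists>x\<in>K \<inter> E. ?u x = 0"
  proof (rule ccontr)
    assume no: "\<not> ?thesis"
    have "AE x in M. x \<notin> K \<inter> E" using ae by (rule AE_mp) (use no in \<open>auto intro!: AE_I2\<close>)
    then have "emeasure M (K \<inter> E) = 0"
      using simplex_props(7)[OF K(1)] E_sets by (subst (asm) AE_iff_measurable) (auto simp: sets_M space_M)
    with pos[OF K(1)] show False by simp
  qed
  then obtain x where x: "x \<in> K" "?u x = 0" by blast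
  show ?thesis
    by (rule nodal_interp_zero_imp_vertices_zero[OF _ K(1) x K(2)]) (rule nonneg)
qed

section \<open>Bilinearity of the Dirichlet form\<close>

lemma grd_constant:
  assumes "u \<in> pw_linear D T" "K \<in> T"
  shows "\<exists>c. \<forall>x\<in>K. grd u x = c"
proof -
  obtain a b where "\<forall>y\<in>K. u y = a \<bullet> y + b" using assms unfolding pw_linear_def by blast
  then show ?thesis using grd_element[OF assms(2)] by blast
qed

lemma grd_combination:
  assumes "u \<in> pw_linear D T" "v \<in> pw_linear D T" "K \<in> T" "x \<in> K"
  shows "grd (\<lambda>x. \<alpha> * u x + \<beta> * v x) x = \<alpha> *\<^sub>R grd u x + \<beta> *\<^sub>R grd v x"
proof -
  obtain a b where u: "\<forall>y\<in>K. u y = a \<bullet> y + b" using assms unfolding pw_linear_def by blast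
  obtain a' b' where v: "\<forall>y\<in>K. v y = a' \<bullet> y + b'" using assms unfolding pw_linear_def by blast
  have w: "\<forall>y\<in>K. \<alpha> * u y + \<beta> * v y = (\<alpha> *\<^sub>R a + \<beta> *\<^sub>R a') \<bullet> y + (\<alpha> * b + \<beta> * b')"
    using u v by (simp add: algebra_simps)
  obtain P where P: "linear P"
    "\<And>u a b. (\<forall>y\<in>K. u y = a \<bullet> y + b) \<Longrightarrow> grd u x = P a"
    using grd_element[OF assms(3)] assms(4) by blast
  show ?thesis
    using P(2)[OF u] P(2)[OF v] P(2)[OF w] P(1) by (simp add: linear_add linear_scale)
qed

lemma grd_cong:
  assumes "u \<in> pw_linear D T" "\<And>x. x \<in> D \<Longrightarrow> u x = v x" "K \<in> T" "x \<in> K"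
  shows "grd v x = grd u x"
proof -
  obtain a b where u: "\<forall>y\<in>K. u y = a \<bullet> y + b" using assms unfolding pw_linear_def by blast
  have "K \<subseteq> D" using closure_subset_D[OF assms(3)] closure_subset by blast
  then have v: "\<forall>y\<in>K. v y = a \<bullet> y + b" using u assms(2)[symmetric] by auto
  show ?thesis using grd_element[OF assms(3)] u v assms(4) by metis
qed

lemma inner_grd_constant:
  assumes "u \<in> pw_linear D T" "v \<in> pw_linear D T" "K \<in> T"
  shows "\<exists>c. \<forall>x\<in>K. grd u x \<bullet> grd v x = c"
proof -
  obtain c c' where "\<forall>x\<in>K. grd u x = c" "\<forall>x\<in>K. grd v x = c'"
    using grd_constant[OF assms(1,3)] grd_constant[OF assms(2,3)] by blast
  then show ?thesis by (intro exI[of _ "c \<bullet> c'"]) simp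
qed

lemma dirichlet_integrable:
  assumes "u \<in> pw_linear D T" "v \<in> pw_linear D T"
  shows "set_integrable (completion M) E (\<lambda>x. grd u x \<bullet> grd v x)"
proof (rule elementwise_constant_integrable)
  fix K assume "K \<in> T"
  then show "\<exists>c. \<forall>x\<in>K. grd u x \<bullet> grd v x = c" using inner_grd_constant assms by simp
qed

lemma dirichlet_combination:
  assumes u: "u \<in> pw_linear D T" and v: "v \<in> pw_linear D T" and w: "w \<in> pw_linear D T"
  shows "dirichlet u (\<lambda>x. \<alpha> * v x + \<beta> * w x) = \<alpha> * dirichlet u v + \<beta> * dirichlet u w"
proof -
  have "dirichlet u (\<lambda>x. \<alpha> * v x + \<beta> * w x) =
      integ (\<lambda>x. \<alpha> * (grd u x \<bullet> grd v x) + \<beta> * (grd u x \<bullet> grd w x))"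
    unfolding dirichlet_def
  proof (rule integ_cong_elementwise)
    fix K x assume "K \<in> T" "x \<in> K"
    then show "grd u x \<bullet> grd (\<lambda>x. \<alpha> * v x + \<beta> * w x) x =
        \<alpha> * (grd u x \<bullet> grd v x) + \<beta> * (grd u x \<bullet> grd w x)"
      by (simp add: grd_combination[OF v w] inner_add_right)
  next
    fix K assume K: "K \<in> T"
    obtain c c' where "\<forall>x\<in>K. grd u x \<bullet> grd v x = c" "\<forall>x\<in>K. grd u x \<bullet> grd w x = c'"
      using inner_grd_constant[OF u v K] inner_grd_constant[OF u w K] by blast
    then show "\<exists>c. \<forall>x\<in>K. \<alpha> * (grd u x \<bullet> grd v x) + \<beta> * (grd u x \<bullet> grd w x) = c"
      by (intro exI[of _ "\<alpha> * c + \<beta> * c'"]) simp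
  qed
  then show ?thesis
    using dirichlet_integrable[OF u v] dirichlet_integrable[OF u w]
    by (simp add: integ_def dirichlet_def)
qed

text \<open>Meant for functions that agree on \<open>D\<close> only, such as \<beta> \<theta> and
  \<mu> on the boundary, whose representatives may differ elsewhere.\<close>

lemma dirichlet_cong:
  assumes "v \<in> pw_linear D T" "\<And>x. x \<in> D \<Longrightarrow> v x = v' x" "u \<in> pw_linear D T"
  shows "dirichlet u v' = dirichlet u v"
  unfolding dirichlet_def
proof (rule integ_cong_elementwise)
  fix K x assume "K \<in> T" "x \<in> K"
  then show "grd u x \<bullet> grd v' x = grd u x \<bullet> grd v x"
    using grd_cong[OF assms(1,2)] by metis
next
  fix K assume "K \<in> T"
  then show "\<exists>c. \<forall>x\<in>K. grd u x \<bullet> grd v x = c" using inner_grd_constant assms by simp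
qed

lemma dirichlet_diff:
  assumes u: "u \<in> pw_linear D T" and v: "v \<in> pw_linear D T"
  shows "dirichlet u (\<lambda>x. u x - v x) = dirichlet u u - dirichlet u v"
  using dirichlet_combination[OF u u v, of 1 "-1"] by simp

lemma integ_norm_grd: "integ (\<lambda>x. (norm (grd u x))\<^sup>2) = dirichlet u u"
  by (simp add: dirichlet_def power2_norm_eq_inner)

text \<open>The integrand contains the difference of two gradients and not the gradient of a
  difference, so the square expands at every point, without an exceptional set.\<close>

lemma integ_norm_grd_diff:
  assumes u: "u \<in> pw_linear D T" and v: "v \<in> pw_linear D T"
  shows "integ (\<lambda>x. (norm (grd u x - grd v x))\<^sup>2) = dirichlet u u - 2 * dirichlet u v + dirichlet v v"
proof -
  have "(norm (grd u x - grd v x))\<^sup>2 =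
      grd u x \<bullet> grd u x - 2 * (grd u x \<bullet> grd v x) + grd v x \<bullet> grd v x" for x
    by (simp add: power2_norm_eq_inner inner_diff inner_commute)
  then show ?thesis
    using dirichlet_integrable[OF u u] dirichlet_integrable[OF u v] dirichlet_integrable[OF v v]
    by (simp add: integ_def dirichlet_def)
qed

end

section \<open>Hausdorff measure of facets\<close>

lemma sets_hausdorff_measure [simp]: "sets (hausdorff_measure k) = sets borel"
  unfolding hausdorff_measure_def
  by (simp add: sigma_algebra.sigma_sets_eq[OF sets.sigma_algebra_axioms[of borel, simplified]])

text \<open>The content is an infimum over sequences, so the finite cover is padded with empty sets;
  they cost nothing because \<open>k > 0\<close> rules out \<open>0 ^ 0\<close>.\<close>

lemma hausdorff_content_le_sum:
  fixes A :: "'a::metric_space set" and C :: "'i \<Rightarrow> 'a set"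
  assumes "k > 0" "\<delta> > 0" "finite I" "A \<subseteq> (\<Union>i\<in>I. C i)"
    and C: "\<And>i. i \<in> I \<Longrightarrow> bounded (C i) \<and> diameter (C i) \<le> \<delta>"
  shows "hausdorff_content k \<delta> A \<le>
    (\<Sum>i\<in>I. ennreal (unit_ball_vol (real k) * (diameter (C i) / 2) ^ k))"
proof -
  define w where "w X = ennreal (unit_ball_vol (real k) * (diameter X / 2) ^ k)" for X :: "'a set"
  obtain h where h: "bij_betw h {..<card I} I"
    using ex_bij_betw_nat_finite[OF \<open>finite I\<close>] by (auto simp: atLeast0LessThan)
  define X where "X j = (if j < card I then C (h j) else {})" for j
  have h_in: "h j \<in> I" if "j < card I" for j
    using h that by (auto simp: bij_betw_def)
  have "A \<subseteq> (\<Union>j. X j)"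
  proof
    fix x assume "x \<in> A"
    then obtain i where i: "i \<in> I" "x \<in> C i" using assms(4) by blast
    then obtain j where "j < card I" "i = h j" using h by (auto simp: bij_betw_def)
    then show "x \<in> (\<Union>j. X j)" using i by (auto simp: X_def)
  qed
  moreover have "bounded (X j) \<and> diameter (X j) \<le> \<delta>" for j
    using C h_in \<open>\<delta> > 0\<close> by (simp add: X_def)
  ultimately have "hausdorff_content k \<delta> A \<le> (\<Sum>j. w (X j))"
    unfolding hausdorff_content_def w_def by (intro INF_lower) auto
  also have "\<dots> = (\<Sum>j<card I. w (X j))"
    by (rule suminf_finite) (auto simp: X_def w_def \<open>k > 0\<close>)
  also have "\<dots> = (\<Sum>j<card I. w (C (h j)))" by (simp add: X_def)
  also have "\<dots> = (\<Sum>i\<in>I. w (C i))" by (rule sum.reindex_bij_betw[OF h])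
  finally show ?thesis by (simp add: w_def)
qed

text \<open>A cover of \<open>A\<close> is pushed forward after intersecting with \<open>A\<close>,
  where alone \<open>f\<close> is Lipschitz; diameters grow at most by the factor \<open>L\<close>.
  The factor stands inverted on the left so that the infimum over covers on the right is handled
  cover by cover.\<close>

lemma hausdorff_content_lipschitz_image:
  fixes f :: "'a::euclidean_space \<Rightarrow> 'b::euclidean_space"
  assumes L: "L > 0" and f: "L-lipschitz_on A f"
  shows "ennreal ((1 / L) ^ k) * hausdorff_content k (L * \<delta>) (f ` A) \<le> hausdorff_content k \<delta> A"
  unfolding hausdorff_content_def[of k \<delta> A]
proof (rule INF_greatest)
  fix C :: "nat \<Rightarrow> 'a set"
  assume "C \<in> {C. A \<subseteq> (\<Union>i. C i) \<and> (\<forall>i. bounded (C i) \<and> diameter (C i) \<le> \<delta>)}"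
  then have cov: "A \<subseteq> (\<Union>i. C i)" and C: "\<And>i. bounded (C i)" "\<And>i. diameter (C i) \<le> \<delta>" by auto
  define X where "X i = f ` (C i \<inter> A)" for i
  have dist_X: "dist x y \<le> L * diameter (C i)" if "x \<in> X i" "y \<in> X i" for x y i
  proof -
    obtain x' y' where "x' \<in> C i \<inter> A" "y' \<in> C i \<inter> A" "x = f x'" "y = f y'"
      using \<open>x \<in> X i\<close> \<open>y \<in> X i\<close> by (auto simp: X_def)
    then have "dist x y \<le> L * dist x' y'" "dist x' y' \<le> diameter (C i)"
      using lipschitz_onD[OF f] diameter_bounded_bound[OF C(1)] by auto
    then show ?thesis using L mult_left_mono[of "dist x' y'" "diameter (C i)" L] by linarith
  qed
  have diam_X: "diameter (X i) \<le> L * diameter (C i)" for i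
    using dist_X L diameter_ge_0[OF C(1)] by (intro diameter_le) (auto simp: dist_norm)
  have bounded_X: "bounded (X i)" for i
    unfolding bounded_two_points using dist_X by blast
  have "f ` A \<subseteq> (\<Union>i. X i)" using cov unfolding X_def by blast
  moreover have "diameter (X i) \<le> L * \<delta>" for i
    using order_trans[OF diam_X mult_left_mono[OF C(2)]] L by simp
  ultimately have "hausdorff_content k (L * \<delta>) (f ` A) \<le>
      (\<Sum>i. ennreal (unit_ball_vol (real k) * (diameter (X i) / 2) ^ k))"
    unfolding hausdorff_content_def using bounded_X by (intro INF_lower) auto
  then have "ennreal ((1 / L) ^ k) * hausdorff_content k (L * \<delta>) (f ` A) \<le>
      (\<Sum>i. ennreal ((1 / L) ^ k) * ennreal (unit_ball_vol (real k) * (diameter (X i) / 2) ^ k))"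
    by (simp add: mult_left_mono)
  also have "\<dots> \<le> (\<Sum>i. ennreal (unit_ball_vol (real k) * (diameter (C i) / 2) ^ k))"
  proof (rule suminf_le)
    fix i
    have "(1 / L) ^ k * (unit_ball_vol (real k) * (diameter (X i) / 2) ^ k)
        = unit_ball_vol (real k) * (1 / L * (diameter (X i) / 2)) ^ k"
      by (simp only: power_mult_distrib ac_simps)
    also have "\<dots> \<le> unit_ball_vol (real k) * (diameter (C i) / 2) ^ k"
      using diam_X[of i] L diameter_ge_0[OF bounded_X[of i]]
      by (intro mult_left_mono power_mono) (auto simp: field_simps)
    finally show "ennreal ((1 / L) ^ k) * ennreal (unit_ball_vol (real k) * (diameter (X i) / 2) ^ k)
        \<le> ennreal (unit_ball_vol (real k) * (diameter (C i) / 2) ^ k)"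
      using L diameter_ge_0[OF bounded_X[of i]] by (simp add: ennreal_mult[symmetric] ennreal_leI)
  qed auto
  finally show "ennreal ((1 / L) ^ k) * hausdorff_content k (L * \<delta>) (f ` A) \<le>
      (\<Sum>i. ennreal (unit_ball_vol (real k) * (diameter (C i) / 2) ^ k))" .
qed

lemma hausdorff_outer_lipschitz_image:
  fixes f :: "'a::euclidean_space \<Rightarrow> 'b::euclidean_space"
  assumes L: "L > 0" and f: "L-lipschitz_on A f"
  shows "hausdorff_outer k (f ` A) \<le> ennreal (L ^ k) * hausdorff_outer k A"
  unfolding hausdorff_outer_def[of k "f ` A"]
proof (rule SUP_least)
  fix \<delta> :: real assume \<delta>: "\<delta> \<in> {0<..}"
  have "hausdorff_content k \<delta> (f ` A) =
      ennreal (L ^ k) * (ennreal ((1 / L) ^ k) * hausdorff_content k (L * (\<delta> / L)) (f ` A))"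
    using L by (simp add: mult.assoc[symmetric] ennreal_mult[symmetric] power_divide)
  also have "\<dots> \<le> ennreal (L ^ k) * hausdorff_content k (\<delta> / L) A"
    by (intro mult_left_mono hausdorff_content_lipschitz_image L f) simp
  also have "\<dots> \<le> ennreal (L ^ k) * hausdorff_outer k A"
    unfolding hausdorff_outer_def using \<delta> L by (intro mult_left_mono SUP_upper) auto
  finally show "hausdorff_content k \<delta> (f ` A) \<le> ennreal (L ^ k) * hausdorff_outer k A" .
qed

text \<open>A grid of mesh \<open>s = R / m\<close> needs at most \<open>(3 m) ^ k\<close> cells of
  diameter at most \<open>k s\<close>. In the product of the two powers \<open>m\<close> cancels,
  which leaves a bound that does not depend on the scale \<delta>.\<close>

lemma hausdorff_outer_slab_finite:
  fixes b :: "'a::euclidean_space"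
  assumes k: "k = DIM('a) - 1" "k > 0" and b: "b \<in> Basis" and R: "R > 0"
  shows "hausdorff_outer k {x::'a. x \<bullet> b = 0 \<and> (\<forall>i\<in>Basis. \<bar>x \<bullet> i\<bar> \<le> R)} < \<infinity>"
proof -
  let ?A = "{x::'a. x \<bullet> b = 0 \<and> (\<forall>i\<in>Basis. \<bar>x \<bullet> i\<bar> \<le> R)}"
  let ?B = "Basis - {b} :: 'a set"
  have card_B: "card ?B = k" using b k by (simp add: card_Diff_singleton)
  have "hausdorff_content k \<delta> ?A \<le> ennreal (unit_ball_vol (real k) * (3 * real k * R / 2) ^ k)"
    if "\<delta> > 0" for \<delta>
  proof -
    \<comment> \<open>Chosen so that the cell diameter bound \<open>k s\<close> is at most \<delta>;
      passing to \<open>Suc m0\<close> keeps the mesh well defined.\<close>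
    obtain m0 :: nat where "real k * R / \<delta> < real m0" using reals_Archimedean2 by blast
    define m where "m = Suc m0"
    have m: "m \<ge> 1" and m_large: "real k * R / \<delta> \<le> real m"
      using \<open>_ < real m0\<close> by (auto simp: m_def)
    define s where "s = R / real m"
    have s: "s > 0" using R m by (simp add: s_def)
    \<comment> \<open>Half-open grid cells in the directions other than \<open>b\<close>. A
      coordinate equal to \<open>R\<close> has floor \<open>m\<close>, so the indices run from
      \<open>- m\<close> to \<open>m\<close> inclusive, which gives \<open>2 m + 1\<close> of them
      per direction.\<close>
    define Q where "Q p = {x::'a. x \<bullet> b = 0 \<and> (\<forall>i\<in>?B. \<lfloor>(x \<bullet> i) / s\<rfloor> = p i)}" for p :: "'a \<Rightarrow> int"
    let ?I = "?B \<rightarrow>\<^sub>E {- int m..int m}"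
    have fin: "finite ?I" by (intro finite_PiE) auto
    have "card {- int m..int m} = 2 * m + 1"
      by (simp add: nat_eq_iff)
    then have card_I: "card ?I = (2 * m + 1) ^ k"
      by (subst card_PiE) (simp_all only: card_B prod_constant finite_Diff finite_Basis)
    have cover: "?A \<subseteq> (\<Union>p\<in>?I. Q p)"
    proof
      fix x assume x: "x \<in> ?A"
      define p where "p = restrict (\<lambda>i. \<lfloor>(x \<bullet> i) / s\<rfloor>) ?B"
      have "\<lfloor>(x \<bullet> i) / s\<rfloor> \<in> {- int m..int m}" if "i \<in> ?B" for i
      proof -
        have "\<bar>x \<bullet> i\<bar> \<le> real m * s" using x \<open>i \<in> ?B\<close> m by (auto simp: s_def)
        then have "- real m \<le> (x \<bullet> i) / s" "(x \<bullet> i) / s \<le> real m"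
          using s by (auto simp: field_simps abs_le_iff)
        then show ?thesis by (auto simp: le_floor_iff floor_le_iff)
      qed
      then have "p \<in> ?I" unfolding p_def by (intro restrict_PiE_iff[THEN iffD2]) blast
      moreover have "x \<in> Q p" using x by (simp add: Q_def p_def)
      ultimately show "x \<in> (\<Union>p\<in>?I. Q p)" by blast
    qed
    have norm_Q: "norm (x - y) \<le> real k * s" if xy: "x \<in> Q p" "y \<in> Q p" for x y p
    proof -
      have "\<bar>(x - y) \<bullet> i\<bar> \<le> s" if i: "i \<in> ?B" for i
      proof -
        have "\<lfloor>(x \<bullet> i) / s\<rfloor> = \<lfloor>(y \<bullet> i) / s\<rfloor>" using xy i by (simp add: Q_def)
        then have "\<bar>(x \<bullet> i) / s - (y \<bullet> i) / s\<bar> \<le> 1" by linarith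
        then show ?thesis using s by (simp add: inner_diff_left diff_divide_distrib[symmetric])
      qed
      moreover have "(x - y) \<bullet> b = 0" using xy by (simp add: Q_def inner_diff_left)
      ultimately have "(\<Sum>i\<in>Basis. \<bar>(x - y) \<bullet> i\<bar>) \<le> real k * s"
        using b sum_bounded_above[of ?B "\<lambda>i. \<bar>(x - y) \<bullet> i\<bar>" s]
        by (simp add: sum.remove[of Basis b] card_B)
      then show ?thesis using norm_le_l1[of "x - y"] by linarith
    qed
    have diam_Q: "diameter (Q p) \<le> real k * s" for p
      using norm_Q s by (intro diameter_le) auto
    have bounded_Q: "bounded (Q p)" for p
      unfolding bounded_two_points dist_norm using norm_Q by blast
    have "real k * s \<le> \<delta>"
      using m_large m \<open>\<delta> > 0\<close> R by (simp add: s_def field_simps)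
    then have "hausdorff_content k \<delta> ?A \<le>
        (\<Sum>p\<in>?I. ennreal (unit_ball_vol (real k) * (diameter (Q p) / 2) ^ k))"
      using diam_Q bounded_Q order_trans
      by (intro hausdorff_content_le_sum k \<open>\<delta> > 0\<close> fin cover) blast
    also have "\<dots> \<le> (\<Sum>p\<in>?I. ennreal (unit_ball_vol (real k) * (real k * s / 2) ^ k))"
      using diam_Q diameter_ge_0[OF bounded_Q]
      by (intro sum_mono ennreal_leI mult_left_mono power_mono) auto
    also have "\<dots> = ennreal (real ((2 * m + 1) ^ k) * (unit_ball_vol (real k) * (real k * s / 2) ^ k))"
      using s by (simp add: card_I ennreal_mult ennreal_of_nat_eq_real_of_nat)
    also have "\<dots> \<le> ennreal (unit_ball_vol (real k) * (3 * real k * R / 2) ^ k)"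
    proof (rule ennreal_leI)
      have "real ((2 * m + 1) ^ k) * (real k * s / 2) ^ k \<le> (3 * real m) ^ k * (real k * s / 2) ^ k"
      proof (rule mult_right_mono)
        have "real ((2 * m + 1) ^ k) = real (2 * m + 1) ^ k" by (rule of_nat_power)
        also have "\<dots> \<le> (3 * real m) ^ k" using m by (intro power_mono) auto
        finally show "real ((2 * m + 1) ^ k) \<le> (3 * real m) ^ k" .
      qed (use s in simp)
      also have "\<dots> = (3 * real m * (real k * s / 2)) ^ k"
        by (simp only: power_mult_distrib)
      also have "3 * real m * (real k * s / 2) = 3 * real k * R / 2"
        using m by (simp add: s_def)
      finally have "unit_ball_vol (real k) * (real ((2 * m + 1) ^ k) * (real k * s / 2) ^ k)
          \<le> unit_ball_vol (real k) * (3 * real k * R / 2) ^ k"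
        by (rule mult_left_mono) simp
      then show "real ((2 * m + 1) ^ k) * (unit_ball_vol (real k) * (real k * s / 2) ^ k)
          \<le> unit_ball_vol (real k) * (3 * real k * R / 2) ^ k"
        by (simp only: mult.left_commute)
    qed
    finally show ?thesis .
  qed
  then have "hausdorff_outer k ?A \<le> ennreal (unit_ball_vol (real k) * (3 * real k * R / 2) ^ k)"
    unfolding hausdorff_outer_def by (intro SUP_least) auto
  also have "\<dots> < \<infinity>" by simp
  finally show ?thesis .
qed

text \<open>As \<open>a\<close> is not orthogonal to \<open>b\<close>, the hyperplane is a Lipschitz
  graph over the coordinate hyperplane orthogonal to \<open>b\<close>: \<open>p\<close> drops the
  coordinate along \<open>b\<close>, and \<open>f\<close> restores it by moving along
  \<open>b\<close> until the equation of the hyperplane holds.\<close>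

lemma hausdorff_outer_hyperplane_finite:
  fixes S :: "'a::euclidean_space set"
  assumes k: "k = DIM('a) - 1" "k > 0" and a: "a \<noteq> 0" and S: "bounded S" "S \<subseteq> {x. a \<bullet> x = c}"
  shows "hausdorff_outer k S < \<infinity>"
proof -
  obtain b where b: "b \<in> Basis" "a \<bullet> b \<noteq> 0" using a euclidean_all_zero_iff[of a] by blast
  define p where "p x = x - (x \<bullet> b) *\<^sub>R b" for x :: 'a
  define f where "f x = x + ((c - a \<bullet> x) / (a \<bullet> b)) *\<^sub>R b" for x
  obtain R0 where "\<And>x. x \<in> S \<Longrightarrow> norm x \<le> R0" using S(1) by (auto simp: bounded_iff)
  define R where "R = max R0 1"
  have R: "R > 0" "\<And>x. x \<in> S \<Longrightarrow> norm x \<le> R"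
    using \<open>\<And>x. x \<in> S \<Longrightarrow> norm x \<le> R0\<close> by (fastforce simp: R_def)+
  let ?A = "{x::'a. x \<bullet> b = 0 \<and> (\<forall>i\<in>Basis. \<bar>x \<bullet> i\<bar> \<le> R)}"
  have "S \<subseteq> f ` ?A"
  proof
    fix x assume x: "x \<in> S"
    have "f (p x) = x"
      using x S(2) b by (auto simp: f_def p_def inner_diff_right)
    moreover have "p x \<in> ?A"
    proof -
      have "p x \<bullet> i = (if i = b then 0 else x \<bullet> i)" if "i \<in> Basis" for i
        using b(1) that by (simp add: p_def inner_diff_left inner_Basis)
      moreover have "\<bar>x \<bullet> i\<bar> \<le> R" if "i \<in> Basis" for i
        using Basis_le_norm[OF that, of x] R(2)[OF x] by linarith
      ultimately show ?thesis using b(1) R(1) by simp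
    qed
    ultimately show "x \<in> f ` ?A" by force
  qed
  then have "hausdorff_outer k S \<le> hausdorff_outer k (f ` ?A)" by (rule hausdorff_outer_mono)
  also have "\<dots> \<le> ennreal ((1 + norm a / \<bar>a \<bullet> b\<bar>) ^ k) * hausdorff_outer k ?A"
  proof (rule hausdorff_outer_lipschitz_image)
    show "1 + norm a / \<bar>a \<bullet> b\<bar> > 0" by (simp add: add_pos_nonneg)
    have "dist (f x) (f y) \<le> (1 + norm a / \<bar>a \<bullet> b\<bar>) * dist x y" for x y
    proof -
      have "f x - f y = (x - y) - ((a \<bullet> (x - y)) / (a \<bullet> b)) *\<^sub>R b"
        by (simp add: f_def algebra_simps diff_divide_distrib add_divide_distrib inner_diff_right)
      then have "dist (f x) (f y) \<le> norm (x - y) + \<bar>a \<bullet> (x - y)\<bar> / \<bar>a \<bullet> b\<bar>"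
        using norm_triangle_ineq4[of "x - y" "((a \<bullet> (x - y)) / (a \<bullet> b)) *\<^sub>R b"] b(1)
        by (simp add: dist_norm)
      also have "\<dots> \<le> norm (x - y) + norm a * norm (x - y) / \<bar>a \<bullet> b\<bar>"
        by (intro add_left_mono divide_right_mono Cauchy_Schwarz_ineq2) auto
      finally show ?thesis by (simp add: dist_norm algebra_simps)
    qed
    then show "(1 + norm a / \<bar>a \<bullet> b\<bar>)-lipschitz_on ?A f"
      by (intro lipschitz_onI) auto
  qed
  also have "\<dots> < \<infinity>"
    using hausdorff_outer_slab_finite[OF k b(1) R(1)] by (simp add: ennreal_mult_less_top)
  finally show ?thesis .
qed

section \<open>Facets: finite measure and null relative boundary\<close>

lemma facet_hyperplane:
  fixes S :: "'a::euclidean_space set"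
  assumes "aff_dim S = int (DIM('a) - 1)"
  obtains a c where "a \<noteq> 0" "affine hull S = {x. a \<bullet> x = c}"
proof -
  have "aff_dim S = int (DIM('a)) - 1"
    using assms by (simp add: of_nat_diff)
  then show ?thesis using aff_dim_eq_hyperplane[of S] that by auto
qed

lemma hausdorff_outer_facet_finite:
  fixes S :: "'a::euclidean_space set"
  assumes "k = DIM('a) - 1" "k > 0" and "bounded S" "aff_dim S = int k"
  shows "hausdorff_outer k S < \<infinity>"
proof -
  obtain a c where "a \<noteq> 0" "affine hull S = {x. a \<bullet> x = c}"
    using facet_hyperplane[of S] assms by blast
  then show ?thesis
    using hausdorff_outer_hyperplane_finite[OF assms(1,2) _ assms(3)] hull_subset[of S affine] by blast
qed

text \<open>
  Shrinking the relative boundary towards a relative interior point produces infinitely many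
  disjoint copies, all of comparable measure, inside a set of finite measure.
\<close>

lemma hausdorff_outer_rel_frontier_null:
  fixes S :: "'a::euclidean_space set"
  assumes k: "k = DIM('a) - 1" "k > 0" and S: "compact S" "convex S" "aff_dim S = int k"
  shows "hausdorff_outer k (S - rel_interior S) = 0"
proof -
  let ?H = "hausdorff_outer k :: 'a set \<Rightarrow> ennreal"
  let ?F = "S - rel_interior S"
  have fin: "?H S < \<infinity>"
    using hausdorff_outer_facet_finite[OF k] S compact_imp_bounded by blast
  have "S \<noteq> {}" using S(3) by auto
  then obtain a where a: "a \<in> rel_interior S" using S(2) rel_interior_eq_empty by blast
  have "compact ?F"
    using compact_rel_boundary[of S] compact_imp_closed[OF S(1)] compact_imp_bounded[OF S(1)]
    by (simp add: compact_eq_bounded_closed closed_rel_boundary bounded_subset[of S])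
  \<comment> \<open>Strict growth of these factors keeps the copies apart along each ray from
    \<open>a\<close>; the lower bound \<open>1/2\<close> makes all inverse dilations Lipschitz with
    the same constant 2.\<close>
  define t :: "nat \<Rightarrow> real" where "t n = real (n + 1) / real (n + 2)" for n
  have t: "1/2 \<le> t n" "t n < 1" for n by (auto simp: t_def field_simps)
  have t_mono: "t m < t n" if "m < n" for m n using that by (simp add: t_def field_simps)
  define g where "g n x = a + t n *\<^sub>R (x - a)" for n x
  have g_inner: "a + r *\<^sub>R (x - a) \<in> rel_interior S" if "x \<in> S" "0 \<le> r" "r < 1" for x r
    using rel_interior_convex_shrink[OF S(2) a \<open>x \<in> S\<close>, of "1 - r"] that by (simp add: algebra_simps)
  have sub: "g n ` ?F \<subseteq> S" for n
  proof -
    have "0 \<le> t n" using t(1)[of n] by linarith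
    then show ?thesis
      using g_inner t(2) rel_interior_subset by (fastforce simp: g_def)
  qed
  have "g m ` ?F \<inter> g n ` ?F = {}" if "m < n" for m n
  proof (rule ccontr)
    assume "\<not> ?thesis"
    then obtain x y where xy: "x \<in> ?F" "y \<in> ?F" "g m x = g n y" by blast
    have tn: "t n > 0" "t m \<ge> 0" using t(1)[of n] t(1)[of m] by linarith+
    \<comment> \<open>If two copies met, \<open>y\<close> would be \<open>x\<close> shrunk towards
      \<open>a\<close> by a factor below 1, hence a relative interior point.\<close>
    have "y = a + (t m / t n) *\<^sub>R (x - a)"
    proof -
      have "t n *\<^sub>R (y - a) = t m *\<^sub>R (x - a)" using xy(3) by (simp add: g_def)
      then have "(1 / t n) *\<^sub>R (t n *\<^sub>R (y - a)) = (1 / t n) *\<^sub>R (t m *\<^sub>R (x - a))" by simp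
      then have "y - a = (t m / t n) *\<^sub>R (x - a)" using tn by simp
      then show ?thesis by (simp add: algebra_simps)
    qed
    then have "y \<in> rel_interior S"
      using g_inner[of x "t m / t n"] xy(1) tn t_mono[OF that] by simp
    then show False using xy(2) by simp
  qed
  then have disj: "disjoint_family (\<lambda>n. g n ` ?F)"
    unfolding disjoint_family_on_def by (metis inf_commute linorder_neqE_nat)
  have meas: "g n ` ?F \<in> sets borel" for n
  proof -
    have "continuous_on ?F (g n)" unfolding g_def by (intro continuous_intros)
    then show ?thesis using compact_continuous_image \<open>compact ?F\<close> borel_compact by blast
  qed
  have lower: "?H ?F \<le> ennreal (2 ^ k) * ?H (g n ` ?F)" for n
  proof -
    define q where "q y = a + (1 / t n) *\<^sub>R (y - a)" for y
    have tn: "t n > 0" using t(1)[of n] by linarith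
    have "q (g n x) = x" for x using tn by (simp add: q_def g_def)
    then have "q ` g n ` ?F = ?F" by (simp add: image_image)
    moreover have "?H (q ` g n ` ?F) \<le> ennreal (2 ^ k) * ?H (g n ` ?F)"
    proof (rule hausdorff_outer_lipschitz_image)
      have "dist (q x) (q y) \<le> 2 * dist x y" for x y
      proof -
        have "q x - q y = (1 / t n) *\<^sub>R (x - y)" by (simp add: q_def algebra_simps)
        moreover have "1 / t n \<le> 2" using tn t(1)[of n] by (simp add: field_simps)
        ultimately show ?thesis
          using tn mult_right_mono[of "1 / t n" 2 "norm (x - y)"] by (simp add: dist_norm)
      qed
      then show "2-lipschitz_on (g n ` ?F) q" by (intro lipschitz_onI) auto
    qed simp
    ultimately show ?thesis by simp
  qed
  have "(\<Sum>n. ?H (g n ` ?F)) = ?H (\<Union>n. g n ` ?F)"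
  proof -
    have "(\<Sum>n. emeasure (hausdorff_measure k) (g n ` ?F))
        = emeasure (hausdorff_measure k) (\<Union>n. g n ` ?F)"
      by (rule suminf_emeasure) (use meas disj in \<open>auto\<close>)
    moreover have U: "(\<Union>n. g n ` ?F) \<in> sets borel" using meas by blast
    ultimately show ?thesis
      unfolding emeasure_hausdorff_measure[OF k(2) meas] emeasure_hausdorff_measure[OF k(2) U] by simp
  qed
  also have "\<dots> \<le> ?H S" using sub by (intro hausdorff_outer_mono) blast
  finally have sum_fin: "(\<Sum>n. ?H (g n ` ?F)) < \<infinity>" using fin by (rule le_less_trans)
  \<comment> \<open>A constant series with finite sum has zero terms.\<close>
  have "(\<Sum>n::nat. ?H ?F) \<le> (\<Sum>n. ennreal (2 ^ k) * ?H (g n ` ?F))"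
    using lower by (intro suminf_le) auto
  also have "\<dots> < \<infinity>" using sum_fin by (simp add: ennreal_mult_less_top)
  finally have "(\<Sum>n::nat. ?H ?F) < \<infinity>" .
  moreover have "(\<Sum>n::nat. ?H ?F) = top * ?H ?F"
    by (simp add: suminf_eq_SUP SUP_mult_right_ennreal[symmetric] ennreal_SUP_of_nat_eq_top)
  ultimately show ?thesis by (cases "?H ?F = 0") (auto simp: ennreal_top_mult)
qed

text \<open>The bridge from Hausdorff to Lebesgue measure. Covering sets of diameter \<rho> become
  boxes of side \<open>2 * \<rho>\<close> in the \<open>k\<close> directions other than
  \<open>b\<close>, while the side along \<open>b\<close> stays bounded. The volumes are then
  controlled by the weights in the Hausdorff content, whose sum can be made arbitrarily
  small.\<close>

lemma hausdorff_null_imp_thickening_negligible: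
  fixes A :: "'a::euclidean_space set"
  assumes k: "k = DIM('a) - 1" "k > 0" and b: "b \<in> Basis" and null: "hausdorff_outer k A = 0"
  shows "negligible {x + t *\<^sub>R b |x t. x \<in> A \<and> t \<in> {0..1}}"
  unfolding negligible_outer_le
proof (intro allI impI)
  fix e :: real assume e: "e > 0"
  define w where "w C = ennreal (unit_ball_vol (real k) * (diameter C / 2) ^ k)" for C :: "'a set"
  \<comment> \<open>The 3 bounds the long side \<open>2 * \<rho> + 1\<close>, using diameters at
    most 1; the power of 4 converts \<open>2 * \<rho>\<close> into the \<open>\<rho> / 2\<close> of
    the content, and the ball volume is its normalisation.\<close>
  define c0 where "c0 = 3 * 4 ^ k / unit_ball_vol (real k)"
  have c0: "c0 > 0" by (simp add: c0_def)
  have "hausdorff_content k 1 A \<le> hausdorff_outer k A"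
    unfolding hausdorff_outer_def by (rule SUP_upper) simp
  then have "hausdorff_content k 1 A < ennreal (e / c0)"
    using null e c0 by simp
  then obtain C where cov: "A \<subseteq> (\<Union>i. C i)" and C: "\<And>i. bounded (C i)" "\<And>i. diameter (C i) \<le> 1"
    and sum: "(\<Sum>i::nat. w (C i)) < ennreal (e / c0)"
    unfolding hausdorff_content_def INF_less_iff w_def by auto
  define z where "z i = (SOME x. x \<in> C i)" for i
  define \<rho> where "\<rho> i = diameter (C i)" for i
  have \<rho>: "0 \<le> \<rho> i" "\<rho> i \<le> 1" for i using C diameter_ge_0[OF C(1)] by (auto simp: \<rho>_def)
  define X where "X i = cbox (z i - \<rho> i *\<^sub>R One) (z i + \<rho> i *\<^sub>R One + b)" for i
  have X_meas: "X i \<in> sets lborel" for i by (simp add: X_def)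
  have "emeasure lborel (X i) \<le> ennreal c0 * w (C i)" for i
  proof -
    have "(\<Prod>j\<in>Basis. ((z i + \<rho> i *\<^sub>R One + b) - (z i - \<rho> i *\<^sub>R One)) \<bullet> j)
        = (\<Prod>j\<in>Basis. 2 * \<rho> i + (if j = b then 1 else 0))"
      using b by (intro prod.cong) (auto simp: inner_add_left inner_diff_left inner_Basis)
    also have "\<dots> = (2 * \<rho> i + 1) * (2 * \<rho> i) ^ k"
      using b k by (simp add: prod.remove[of Basis b] card_Diff_singleton)
    also have "\<dots> \<le> 3 * (2 * \<rho> i) ^ k"
      using \<rho>[of i] by (intro mult_right_mono) auto
    also have "\<dots> = c0 * (unit_ball_vol (real k) * (\<rho> i / 2) ^ k)"
    proof -
      have "(2 * \<rho> i) ^ k = (4 * (\<rho> i / 2)) ^ k" by simp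
      also have "\<dots> = 4 ^ k * (\<rho> i / 2) ^ k" by (simp only: power_mult_distrib)
      moreover have "unit_ball_vol (real k) \<noteq> 0"
        using unit_ball_vol_pos[of "real k"] by (metis less_irrefl of_nat_0_le_iff)
      ultimately show ?thesis by (simp add: c0_def)
    qed
    finally have "emeasure lborel (X i) \<le> ennreal (c0 * (unit_ball_vol (real k) * (\<rho> i / 2) ^ k))"
      unfolding X_def emeasure_lborel_cbox_eq by (auto intro: ennreal_leI)
    then show ?thesis using c0 \<rho>(1)[of i] by (simp add: w_def \<rho>_def ennreal_mult)
  qed
  then have "(\<Sum>i. emeasure lborel (X i)) \<le> (\<Sum>i. ennreal c0 * w (C i))"
    by (intro suminf_le) auto
  also have "\<dots> \<le> ennreal c0 * ennreal (e / c0)"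
    using sum by (simp add: mult_left_mono less_imp_le)
  also have "\<dots> = ennreal e" using c0 e by (simp add: ennreal_mult[symmetric])
  finally have em: "emeasure lborel (\<Union>i. X i) \<le> ennreal e"
    using emeasure_subadditive_countably[of X lborel] X_meas by (auto intro: order_trans)
  have UX: "(\<Union>i. X i) \<in> sets lborel" using X_meas by blast
  have "{x + t *\<^sub>R b |x t. x \<in> A \<and> t \<in> {0..1}} \<subseteq> (\<Union>i. X i)"
  proof clarify
    fix x and t :: real assume x: "x \<in> A" and t: "t \<in> {0..1}"
    then obtain i where i: "x \<in> C i" using cov by blast
    then have "z i \<in> C i" unfolding z_def by (rule someI)
    then have d: "norm (x - z i) \<le> \<rho> i"
      using diameter_bounded_bound[OF C(1) i] by (simp add: \<rho>_def dist_norm)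
    have "x + t *\<^sub>R b \<in> X i"
      unfolding X_def mem_box
    proof
      fix j :: 'a assume j: "j \<in> Basis"
      have "\<bar>(x - z i) \<bullet> j\<bar> \<le> \<rho> i" using Basis_le_norm[OF j, of "x - z i"] d by linarith
      then show "(z i - \<rho> i *\<^sub>R One) \<bullet> j \<le> (x + t *\<^sub>R b) \<bullet> j \<and>
          (x + t *\<^sub>R b) \<bullet> j \<le> (z i + \<rho> i *\<^sub>R One + b) \<bullet> j"
        using t b j by (auto simp: inner_add_left inner_diff_left inner_Basis abs_le_iff)
    qed
    then show "x + t *\<^sub>R b \<in> (\<Union>i. X i)" by blast
  qed
  moreover have "(\<Union>i. X i) \<in> lmeasurable"
    using em UX by (intro fmeasurableI) (auto simp: le_less_trans)
  moreover have "measure lebesgue (\<Union>i. X i) \<le> e"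
    using em UX e by (simp add: measure_def enn2real_leI)
  ultimately show "\<exists>T. {x + t *\<^sub>R b |x t. x \<in> A \<and> t \<in> {0..1}} \<subseteq> T \<and> T \<in> lmeasurable \<and>
      measure lebesgue T \<le> e"
    by blast
qed

text \<open>By contradiction: a null facet would have a negligible thickening along a coordinate
  direction \<open>b\<close> transversal to its hyperplane. That thickening is a Minkowski sum of
  convex sets of full dimension, so it has interior points.\<close>

lemma hausdorff_outer_facet_pos:
  fixes S :: "'a::euclidean_space set"
  assumes k: "k = DIM('a) - 1" "k > 0" and S: "convex S" "aff_dim S = int k"
  shows "hausdorff_outer k S > 0"
proof (rule ccontr)
  assume "\<not> ?thesis"
  then have null: "hausdorff_outer k S = 0" by simp
  obtain a c where a: "a \<noteq> 0" "affine hull S = {x. a \<bullet> x = c}"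
    using facet_hyperplane[of S] S k by blast
  obtain b where b: "b \<in> Basis" "a \<bullet> b \<noteq> 0" using a(1) euclidean_all_zero_iff[of a] by blast
  let ?X = "{x + t *\<^sub>R b |x t. x \<in> S \<and> t \<in> {0..1}}"
  have X_eq: "?X = (\<Union>x\<in>S. \<Union>y\<in>(\<lambda>t. t *\<^sub>R b) ` {0..1}. {x + y})" by (auto simp: image_iff; metis atLeastAtMost_iff)
  have "convex ((\<lambda>t. t *\<^sub>R b) ` {0..1})"
    by (intro convex_linear_image linearI) (auto simp: algebra_simps)
  then have conv: "convex ?X" unfolding X_eq by (rule convex_sums[OF S(1)])
  have "S \<noteq> {}" using S(2) by auto
  then obtain p where p: "p \<in> S" by auto
  have pS: "a \<bullet> p = c" using p a(2) hull_inc[of p S affine] by blast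
  have "p + b \<notin> affine hull S" using a(2) b(2) pS by (simp add: inner_add_right)
  then have "aff_dim (insert (p + b) S) = int DIM('a)"
    using S(2) k by (simp add: aff_dim_insert)
  moreover have "insert (p + b) S \<subseteq> ?X"
  proof -
    have "p + b \<in> ?X" using p by (intro CollectI exI[of _ p] exI[of _ 1]) auto
    moreover have "x \<in> ?X" if "x \<in> S" for x
      using that by (intro CollectI exI[of _ x] exI[of _ 0]) auto
    ultimately show ?thesis by blast
  qed
  ultimately have "aff_dim ?X = int DIM('a)"
    using aff_dim_subset[of "insert (p + b) S" ?X] aff_dim_le_DIM[of ?X] by linarith
  moreover have "?X \<noteq> {}" using p \<open>insert (p + b) S \<subseteq> ?X\<close> by blast
  ultimately have "interior ?X \<noteq> {}"
    using interior_rel_interior_gen[of ?X] rel_interior_eq_empty[OF conv] by simp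
  then show False
    using hausdorff_null_imp_thickening_negligible[OF k b(1) null] negligible_convex_interior[OF conv]
    by blast
qed

section \<open>Gradients and surface gradients of piecewise linear functions\<close>

context conforming_partition
begin

text \<open>A point of an open element lies in no other closed element \<open>closure L\<close>: the
  common face would contain a relative interior point of \<open>closure K\<close>, hence all of it,
  and equal dimensions would force \<open>K = L\<close>. Near the point \<open>D\<close> therefore
  consists of \<open>K\<close> alone, so derivatives within \<open>D\<close> are derivatives within
  a convex flat piece.\<close>

lemma element_locally_all:
  assumes K: "K \<in> T" and x: "x \<in> K"
  shows "\<exists>e>0. ball x e \<inter> D \<subseteq> K"
proof -
  let ?C = "\<Union>L\<in>T - {K}. closure L"
  have "closed ?C" using finite_T by (intro closed_UN) auto
  have "x \<notin> ?C"
  proof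
    assume "x \<in> ?C"
    then obtain L where L: "L \<in> T" "L \<noteq> K" "x \<in> closure L" by blast
    have "closure K \<subseteq> closure K \<inter> closure L"
    proof (rule subset_of_face_of[OF conforming[OF K L(1)]])
      have "x \<in> rel_interior (closure K)" using x simplex_props(5)[OF K] by simp
      moreover have "x \<in> closure K" using x closure_subset by blast
      ultimately show "closure K \<inter> closure L \<inter> rel_interior (closure K) \<noteq> {}"
        using L(3) by blast
    qed simp
    then have eq: "closure L \<inter> closure K = closure K" by blast
    have "closure K face_of closure L"
      using conforming[OF L(1) K] by (simp only: eq)
    then have "closure K = closure L"
      using face_of_aff_dim_lt[OF simplex_props(3)[OF L(1)], of "closure K"]
        simplex_props(6)[OF K] simplex_props(6)[OF L(1)] by auto
    then show False using simplex_props(5)[OF K] simplex_props(5)[OF L(1)] L(2) by simp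
  qed
  then obtain e1 where e1: "e1 > 0" "ball x e1 \<subseteq> - ?C"
    using openE[OF open_Compl[OF \<open>closed ?C\<close>], of x] by blast
  have "x \<in> rel_interior (closure K)" using x simplex_props(5)[OF K] by simp
  then obtain e2 where e2: "e2 > 0" "ball x e2 \<inter> affine hull (closure K) \<subseteq> rel_interior (closure K)"
    using conjunct2[OF openin_rel_interior[of "closure K", unfolded openin_contains_ball]] by blast
  have "ball x (min e1 e2) \<inter> D \<subseteq> K"
  proof
    fix y assume y: "y \<in> ball x (min e1 e2) \<inter> D"
    then have "y \<notin> ?C" using e1 by auto
    then have "y \<in> closure K" using y by (auto simp: D_eq)
    then have "y \<in> affine hull (closure K)" by (rule hull_inc)
    then show "y \<in> K" using y e2 simplex_props(5)[OF K] by auto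
  qed
  then show ?thesis using e1(1) e2(1) by (intro exI[of _ "min e1 e2"]) auto
qed

end

text \<open>Tangent vectors at \<open>x\<close> are limits of multiples of secants into
  \<open>K\<close>, and the span is closed; conversely each \<open>y - x\<close> is attained by
  points moving along the segment to \<open>x\<close> with factors \<open>Suc i\<close>. Differences
  of arbitrary points of \<open>K\<close> are used so that the right-hand side does not depend on
  \<open>x\<close>.\<close>

lemma tangent_space_locally_convex:
  fixes S K :: "'a::euclidean_space set"
  assumes e: "e > 0" "ball x e \<inter> S \<subseteq> K" and K: "K \<subseteq> S" "convex K" "x \<in> K"
  shows "tangent_space S x = span {y - z |y z. y \<in> K \<and> z \<in> K}" (is "_ = span ?G")
proof
  let ?C = "{v. \<exists>y t. (\<forall>i. y i \<in> S \<and> 0 < t i) \<and> y \<longlonglongrightarrow> x \<and> (\<lambda>i::nat. t i *\<^sub>R (y i - x)) \<longlonglongrightarrow> v}"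
  show "tangent_space S x \<subseteq> span ?G"
    unfolding tangent_space_def
  proof (rule span_minimal[OF _ subspace_span], clarify)
    fix v y and t :: "nat \<Rightarrow> real"
    assume y: "\<forall>i. y i \<in> S \<and> 0 < t i" "y \<longlonglongrightarrow> x" and lim: "(\<lambda>i. t i *\<^sub>R (y i - x)) \<longlonglongrightarrow> v"
    have "\<forall>\<^sub>F i in sequentially. y i \<in> ball x e"
      using tendstoD[OF y(2) e(1)] by (simp add: dist_commute)
    then have "\<forall>\<^sub>F i in sequentially. t i *\<^sub>R (y i - x) \<in> span ?G"
    proof (rule eventually_mono)
      fix i assume "y i \<in> ball x e"
      then have "y i \<in> K" using e(2) y(1) by blast
      then have "y i - x \<in> ?G" using K(3) by blast
      then show "t i *\<^sub>R (y i - x) \<in> span ?G" by (intro span_scale span_base)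
    qed
    then show "v \<in> span ?G"
      by (rule Lim_in_closed_set[OF closed_subspace[OF subspace_span] _ _ lim]) simp
  qed
  have cone: "y - x \<in> span ?C" if y: "y \<in> K" for y
  proof (rule span_base, rule CollectI, intro exI conjI allI)
    fix i :: nat
    let ?y = "\<lambda>i. x + (1 / real (Suc i)) *\<^sub>R (y - x)"
    show "?y i \<in> S"
    proof -
      have "(1 - 1 / real (Suc i)) *\<^sub>R x + (1 / real (Suc i)) *\<^sub>R y \<in> K"
        using K(2,3) y by (intro convexD_alt) auto
      then show ?thesis using K(1) by (auto simp: algebra_simps)
    qed
    show "0 < real (Suc i)" by simp
    show "?y \<longlonglongrightarrow> x"
      using tendsto_add[OF tendsto_const[of x] tendsto_scaleR[OF lim_inverse_n'[THEN LIMSEQ_Suc] tendsto_const[of "y - x"]]]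
      by simp
    show "(\<lambda>i. real (Suc i) *\<^sub>R (?y i - x)) \<longlonglongrightarrow> y - x" by simp
  qed
  show "span ?G \<subseteq> tangent_space S x"
    unfolding tangent_space_def
  proof (rule span_minimal[OF _ subspace_span], clarify)
    fix y z assume "y \<in> K" "z \<in> K"
    then have "(y - x) - (z - x) \<in> span ?C" by (intro span_diff cone)
    then show "y - z \<in> span ?C" by simp
  qed
qed

text \<open>Supplies the slope map of the surface gradient, which sees only the component of a slope
  in the direction space of the facet.\<close>

lemma linear_orthogonal_projection_exists:
  fixes G :: "'a::euclidean_space set"
  shows "\<exists>P. linear P \<and> (\<forall>a. P a \<in> span G \<and> (\<forall>w\<in>span G. P a \<bullet> w = a \<bullet> w))"
proof -
  have "\<exists>y. y \<in> span G \<and> (\<forall>w\<in>span G. y \<bullet> w = a \<bullet> w)" for a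
  proof -
    obtain y z where yz: "y \<in> span G" "\<And>w. w \<in> span G \<Longrightarrow> orthogonal z w" "a = y + z"
      by (rule orthogonal_subspace_decomp_exists[of G a]) blast
    then show ?thesis by (intro exI[of _ y]) (auto simp: orthogonal_def inner_add_left)
  qed
  then obtain P where P: "\<And>a. P a \<in> span G" "\<And>a w. w \<in> span G \<Longrightarrow> P a \<bullet> w = a \<bullet> w" by metis
  have uniq: "y = z" if "y \<in> span G" "z \<in> span G" "\<And>w. w \<in> span G \<Longrightarrow> y \<bullet> w = z \<bullet> w" for y z
  proof -
    have "(y - z) \<bullet> (y - z) = 0" using that(3)[OF span_diff[OF that(1,2)]] by (simp add: inner_diff_left)
    then show ?thesis by simp
  qed
  have "linear P"
    by (intro linearI uniq) (auto simp: P inner_add_left intro: P span_add span_scale)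
  then show ?thesis using P by blast
qed

text \<open>The vectors \<open>a\<close> and \<open>v\<close> give the same increments inside
  \<open>K\<close>, and \<open>S\<close> is \<open>K\<close> near \<open>x\<close>; this makes
  \<open>v\<close> a gradient. Any other candidate is compared with it along segments issuing from
  \<open>x\<close>, whose directions span the tangent space.\<close>

lemma surface_grad_locally_affine:
  fixes S K :: "'a::euclidean_space set"
  assumes e: "e > 0" "ball x e \<inter> S \<subseteq> K" and K: "K \<subseteq> S" "convex K" "x \<in> K"
    and u: "\<And>y. y \<in> K \<Longrightarrow> u y = a \<bullet> y + b"
    and v: "v \<in> span {y - z |y z. y \<in> K \<and> z \<in> K}"
      "\<And>w. w \<in> span {y - z |y z. y \<in> K \<and> z \<in> K} \<Longrightarrow> v \<bullet> w = a \<bullet> w"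
  shows "surface_grad S u x = v"
  unfolding surface_grad_def tangent_space_locally_convex[OF e K]
proof (rule the_equality)
  let ?G = "{y - z |y z. y \<in> K \<and> z \<in> K}"
  have "((\<lambda>y. v \<bullet> (y - x) + u x) has_derivative (\<lambda>h. v \<bullet> h)) (at x within S)"
    by (auto intro!: derivative_eq_intros)
  then have der: "(u has_derivative (\<lambda>h. v \<bullet> h)) (at x within S)"
  proof (rule has_derivative_transform_within[OF _ e(1)])
    show "x \<in> S" using K by blast
    fix y assume "y \<in> S" "dist y x < e"
    then have y: "y \<in> K" using e(2) by (auto simp: dist_commute)
    then have "y - x \<in> span ?G" using K(3) by (intro span_base) blast
    then have "v \<bullet> (y - x) = a \<bullet> (y - x)" by (rule v(2))
    then show "v \<bullet> (y - x) + u x = u y" using u y K(3) by (simp add: inner_diff_right)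
  qed
  with v(1) show "v \<in> span ?G \<and> (u has_derivative (\<lambda>h. v \<bullet> h)) (at x within S)" by blast
  fix w assume w: "w \<in> span ?G \<and> (u has_derivative (\<lambda>h. w \<bullet> h)) (at x within S)"
  have eq: "w \<bullet> (y - x) = v \<bullet> (y - x)" if y: "y \<in> K" for y
  proof -
    define c where "c s = x + s *\<^sub>R (y - x)" for s :: real
    have "c s \<in> K" if "s \<in> {0..1}" for s
    proof -
      have "(1 - s) *\<^sub>R x + s *\<^sub>R y \<in> K" using K(2,3) y that by (intro convexD_alt) auto
      then show ?thesis by (simp add: c_def algebra_simps)
    qed
    then have sub: "c ` {0..1} \<subseteq> S" using K(1) by blast
    have c: "(c has_derivative (\<lambda>s. s *\<^sub>R (y - x))) (at 0 within {0..1})"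
      unfolding c_def by (auto intro!: derivative_eq_intros)
    \<comment> \<open>The segment stays in \<open>S\<close>, so a derivative within \<open>S\<close>
      may be composed with it. The one-sided derivative at 0 is unique because 0 is a limit point of
      the unit interval.\<close>
    have along: "((\<lambda>s. u (c s)) has_vector_derivative p \<bullet> (y - x)) (at 0 within {0..1})"
      if "(u has_derivative (\<lambda>h. p \<bullet> h)) (at x within S)" for p
    proof -
      have "(u has_derivative (\<lambda>h. p \<bullet> h)) (at (c 0) within c ` {0..1})"
        using has_derivative_subset[OF that sub] by (simp add: c_def)
      from has_derivative_in_compose[OF c this]
      show ?thesis by (simp add: has_vector_derivative_def)
    qed
    have "at 0 within {0..1::real} \<noteq> bot"
      by (simp add: trivial_limit_within islimpt_Icc)
    then show ?thesis
      using vector_derivative_unique_within[OF _ along along] w der by blast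
  qed
  have "orthogonal (w - v) g" if gG: "g \<in> ?G" for g
  proof -
    obtain y z where g: "g = y - z" "y \<in> K" "z \<in> K" using gG by blast
    have "(w - v) \<bullet> g = (w - v) \<bullet> (y - x) - (w - v) \<bullet> (z - x)"
      by (simp add: g(1) inner_diff_right)
    then show ?thesis using eq g(2,3) by (simp add: orthogonal_def inner_diff_left)
  qed
  then have "orthogonal (w - v) g" if "g \<in> span ?G" for g
    using that orthogonal_to_span[of g ?G "w - v"] by blast
  then have "orthogonal (w - v) (w - v)" using w v(1) by (simp add: span_diff)
  then show "w = v" by (simp add: orthogonal_def)
qed

lemma grad_locally_affine:
  fixes K :: "'a::euclidean_space set"
  assumes "open K" "x \<in> K" and u: "\<And>y. y \<in> K \<Longrightarrow> u y = a \<bullet> y + b"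
  shows "grad u x = a"
  unfolding grad_def
proof (rule the_equality)
  have "((\<lambda>y. a \<bullet> y + b) has_derivative (\<lambda>h. h \<bullet> a)) (at x)"
    by (auto intro!: derivative_eq_intros simp: inner_commute)
  then have der: "(u has_derivative (\<lambda>h. h \<bullet> a)) (at x)"
    by (rule has_derivative_transform_within_open[OF _ assms(1,2)]) (simp add: u)
  then show "GDERIV u x :> a" by (simp add: gderiv_def)
  fix v assume "GDERIV u x :> v"
  then have "(\<lambda>h. h \<bullet> v) = (\<lambda>h. h \<bullet> a)"
    using has_derivative_unique[OF _ der] by (simp add: gderiv_def)
  then have "h \<bullet> (v - a) = 0" for h by (metis inner_diff_right right_minus_eq)
  then show "v = a" by (metis inner_eq_zero_iff right_minus_eq)
qed

section \<open>The domain and its boundary as instances of the abstract space\<close>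

lemma bulk_finite_element_space:
  fixes \<Omega> :: "'a::euclidean_space set"
  assumes \<Omega>: "convex_polytopal_domain \<Omega>" and part: "bulk_surface_partitions \<Omega> T T\<^sub>\<Gamma>" and h: "h > 0"
  shows "finite_element_space DIM('a) (closure \<Omega>) (T h) lborel \<Omega> grad"
proof -
  have simpl: "simplicial_partition DIM('a) (closure \<Omega>) (T h)" and tri: "triangulation (closure ` T h)"
    using part h unfolding bulk_surface_partitions_def by blast+
  interpret conforming_partition "DIM('a)" "closure \<Omega>" "T h"
  proof
    show "closure K \<inter> closure L face_of closure K" if "K \<in> T h" "L \<in> T h" for K L
      using tri that unfolding triangulation_def by blast
  qed (rule simpl)
  \<comment> \<open>A simplex of full dimension has its relative interior as interior, so bulk
    elements are open and the ordinary gradient is determined on them.\<close>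
  have int: "K = interior (closure K)" if K: "K \<in> T h" for K
    using simplex_props(5)[OF K] interior_rel_interior_gen[of "closure K"] simplex_props(6)[OF K] by simp
  then have op: "open K" if "K \<in> T h" for K using that by (metis open_interior)
  show ?thesis
  proof unfold_locales
    show "\<Omega> \<in> sets borel" using \<Omega> by (simp add: convex_polytopal_domain_def)
    show "emeasure lborel \<Omega> < \<infinity>"
      by (rule emeasure_bounded_finite) (use \<Omega> in \<open>simp add: convex_polytopal_domain_def\<close>)
    show "AE x in lborel. x \<in> \<Omega> \<longrightarrow> x \<in> \<Union> (T h)"
    proof -
      have "AE x in lborel. x \<notin> frontier K" if "K \<in> T h" for K
        using AE_not_in[of "frontier K" lebesgue] negligible_convex_frontier[OF simplex_props(1)[OF that]]
        by (simp add: negligible_iff_null_sets AE_completion_iff)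
      then have "AE x in lborel. \<forall>K\<in>T h. x \<notin> frontier K"
        by (simp add: AE_finite_all[OF finite_T])
      then show ?thesis
      proof (rule AE_mp, intro AE_I2 impI)
        fix x assume x: "\<forall>K\<in>T h. x \<notin> frontier K" "x \<in> \<Omega>"
        then obtain K where K: "K \<in> T h" "x \<in> closure K" 
          using subsetD[OF closure_subset x(2)] unfolding D_eq by blast
        moreover have "x \<notin> frontier K" using x(1) K(1) by blast
        ultimately have "x \<in> K" using op[OF K(1)] by (simp add: frontier_def interior_open)
        then show "x \<in> \<Union> (T h)" using K(1) by blast
      qed
    qed
    fix K assume K: "K \<in> T h"
    show "\<exists>P. linear P \<and> (\<forall>u a b x. (\<forall>y\<in>K. u y = a \<bullet> y + b) \<longrightarrow> x \<in> K \<longrightarrow> grad u x = P a)"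
    proof (intro exI[of _ "\<lambda>a. a"] conjI allI impI)
      show "linear (\<lambda>a::'a. a)" by (intro linearI) auto
      fix u :: "'a \<Rightarrow> real" and a b x assume "\<forall>y\<in>K. u y = a \<bullet> y + b" "x \<in> K"
      then show "grad u x = a" by (intro grad_locally_affine[OF op[OF K]]) auto
    qed
  qed (auto simp: closure_subset)
qed

text \<open>
  A segment of the closed domain that meets the boundary in an inner point lies in the boundary, by
  convexity; hence the trace of an element on the boundary is one of its faces.
\<close>

lemma face_of_Int_frontier:
  fixes \<Omega> C :: "'a::euclidean_space set"
  assumes \<Omega>: "open \<Omega>" "convex \<Omega>" and C: "C \<subseteq> closure \<Omega>" "convex (C \<inter> frontier \<Omega>)"
  shows "C \<inter> frontier \<Omega> face_of C"
  unfolding face_of_def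
proof (intro conjI ballI impI)
  have fr: "frontier \<Omega> = closure \<Omega> - \<Omega>" using \<Omega>(1) by (simp add: frontier_def interior_open)
  have seg: "a \<notin> \<Omega>" if "b \<in> closure \<Omega>" "x \<in> open_segment a b" "x \<in> frontier \<Omega>" for a b x
    using in_interior_closure_convex_segment[OF \<Omega>(2), of a b] that \<Omega>(1) fr
    by (auto simp: interior_open)
  fix a b x assume ab: "a \<in> C" "b \<in> C" "x \<in> C \<inter> frontier \<Omega>" "x \<in> open_segment a b"
  then have "a \<notin> \<Omega>" "b \<notin> \<Omega>"
    using seg[of b x a] seg[of a x b] C(1) by (auto simp: open_segment_commute)
  then show "a \<in> C \<inter> frontier \<Omega>" "b \<in> C \<inter> frontier \<Omega>" using ab C(1) fr by auto
qed (use C in auto)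

lemma surface_finite_element_space:
  fixes \<Omega> :: "'a::euclidean_space set"
  assumes dim: "DIM('a) \<ge> 2" and \<Omega>: "convex_polytopal_domain \<Omega>"
    and part: "bulk_surface_partitions \<Omega> T T\<^sub>\<Gamma>" and h: "h > 0"
  shows "finite_element_space (DIM('a) - 1) (frontier \<Omega>) (T\<^sub>\<Gamma> h)
      (hausdorff_measure (DIM('a) - 1)) (frontier \<Omega>) (surface_grad (frontier \<Omega>))"
proof -
  let ?k = "DIM('a) - 1"
  have k: "?k > 0" using dim by simp
  have simpl: "simplicial_partition ?k (frontier \<Omega>) (T\<^sub>\<Gamma> h)"
    and bulk: "simplicial_partition DIM('a) (closure \<Omega>) (T h)"
    and tri: "triangulation (closure ` T h)"
    and trace: "\<And>K. K \<in> T\<^sub>\<Gamma> h \<Longrightarrow> \<exists>L\<in>T h. closure K = closure L \<inter> frontier \<Omega>"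
    using part h unfolding bulk_surface_partitions_def by blast+
  have \<Omega>_props: "open \<Omega>" "convex \<Omega>" using \<Omega> by (auto simp: convex_polytopal_domain_def)
  have facet: "closure K face_of closure L"
    if "K \<in> T\<^sub>\<Gamma> h" "L \<in> T h" "closure K = closure L \<inter> frontier \<Omega>" for K L
  proof -
    have "convex (closure K)"
      using open_simplex_props(3) that(1) simpl by (auto simp: simplicial_partition_def)
    moreover have "closure L \<subseteq> closure \<Omega>" using bulk that(2) by (auto simp: simplicial_partition_def)
    ultimately show ?thesis using face_of_Int_frontier[OF \<Omega>_props, of "closure L"] that(3) by simp
  qed
  interpret conforming_partition ?k "frontier \<Omega>" "T\<^sub>\<Gamma> h"
  proof
    fix K K' assume K: "K \<in> T\<^sub>\<Gamma> h" and K': "K' \<in> T\<^sub>\<Gamma> h"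
    obtain L where L: "L \<in> T h" "closure K = closure L \<inter> frontier \<Omega>" using trace[OF K] by blast
    obtain L' where L': "L' \<in> T h" "closure K' = closure L' \<inter> frontier \<Omega>" using trace[OF K'] by blast
    \<comment> \<open>Conformity is inherited from the bulk: a facet of \<open>L\<close> met with
      the common face of \<open>L\<close> and \<open>L'\<close> is again a face of \<open>L\<close>.
      It equals the intersection of the two boundary elements, and a face contained in
      \<open>closure K\<close> is a face of \<open>closure K\<close>.\<close>
    have "closure L \<inter> closure L' face_of closure L"
      using tri L(1) L'(1) by (auto simp: triangulation_def)
    then have "closure K \<inter> (closure L \<inter> closure L') face_of closure L"
      by (rule face_of_Int[OF facet[OF K L]])
    moreover have "closure K \<inter> (closure L \<inter> closure L') = closure K \<inter> closure K'"
      using L(2) L'(2) by blast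
    moreover have "closure K \<subseteq> closure L" using L(2) by blast
    ultimately show "closure K \<inter> closure K' face_of closure K"
      using face_of_subset[of "closure K \<inter> closure K'" "closure L" "closure K"] by auto
  qed (rule simpl)
  let ?M = "hausdorff_measure ?k :: 'a measure"
  show ?thesis
  proof unfold_locales
    show "frontier \<Omega> \<in> sets borel" by simp
    have fin: "emeasure ?M (closure K) < \<infinity>" if K: "K \<in> T\<^sub>\<Gamma> h" for K
      using hausdorff_outer_facet_finite[OF refl k compact_imp_bounded[OF simplex_props(2)[OF K]]
          simplex_props(6)[OF K]]
      by (subst emeasure_hausdorff_measure[OF k]) simp_all
    have "emeasure ?M (\<Union>K\<in>T\<^sub>\<Gamma> h. closure K) \<le> (\<Sum>K\<in>T\<^sub>\<Gamma> h. emeasure ?M (closure K))"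
      using finite_T by (intro emeasure_subadditive_finite) auto
    also have "\<dots> < \<infinity>" using fin finite_T by simp
    finally show "emeasure ?M (frontier \<Omega>) < \<infinity>" unfolding D_eq .
    show "AE x in ?M. x \<in> frontier \<Omega> \<longrightarrow> x \<in> \<Union> (T\<^sub>\<Gamma> h)"
    proof -
      have "AE x in ?M. x \<notin> closure K - K" if K: "K \<in> T\<^sub>\<Gamma> h" for K
      proof (rule AE_not_in)
        have "hausdorff_outer ?k (closure K - K) = 0"
          using hausdorff_outer_rel_frontier_null[OF refl k simplex_props(2,3,6)[OF K]]
            simplex_props(5)[OF K] by simp
        moreover have "closure K - K \<in> sets borel" using simplex_props(7)[OF K] by simp
        ultimately show "closure K - K \<in> null_sets ?M"
          by (intro null_setsI) (subst emeasure_hausdorff_measure[OF k], simp_all)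
      qed
      then have "AE x in ?M. \<forall>K\<in>T\<^sub>\<Gamma> h. x \<notin> closure K - K"
        by (simp add: AE_finite_all[OF finite_T])
      then show ?thesis
      proof (rule AE_mp, intro AE_I2 impI)
        fix x assume x: "\<forall>K\<in>T\<^sub>\<Gamma> h. x \<notin> closure K - K" "x \<in> frontier \<Omega>"
        then obtain K where "K \<in> T\<^sub>\<Gamma> h" "x \<in> closure K" unfolding D_eq by blast
        then show "x \<in> \<Union> (T\<^sub>\<Gamma> h)" using x(1) by blast
      qed
    qed
    fix K assume K: "K \<in> T\<^sub>\<Gamma> h"
    \<comment> \<open>The direction set is the same for every point of the facet, so one projection
      \<open>P\<close> works on all of \<open>K\<close>.\<close>
    let ?G = "{y - z |y z. y \<in> K \<and> z \<in> K}"
    obtain P where P: "linear P" "\<And>a. P a \<in> span ?G" "\<And>a w. w \<in> span ?G \<Longrightarrow> P a \<bullet> w = a \<bullet> w"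
      using linear_orthogonal_projection_exists[of ?G] by blast
    have "surface_grad (frontier \<Omega>) u x = P a" if u: "\<forall>y\<in>K. u y = a \<bullet> y + b" and x: "x \<in> K" for u a b x
    proof -
      obtain e where e: "e > 0" "ball x e \<inter> frontier \<Omega> \<subseteq> K"
        using element_locally_all[OF K x] by blast
      have "K \<subseteq> frontier \<Omega>" using closure_subset_D[OF K] closure_subset by blast
      then show ?thesis
        using u P(2,3) by (intro surface_grad_locally_affine[OF e _ simplex_props(1)[OF K] x]) auto
    qed
    then show "\<exists>P. linear P \<and> (\<forall>u a b x. (\<forall>y\<in>K. u y = a \<bullet> y + b) \<longrightarrow> x \<in> K \<longrightarrow>
        surface_grad (frontier \<Omega>) u x = P a)"
      using P(1) by blast
  qed auto
qed

text \<open>The trace of a bulk function is the function itself, and each boundary element lies in a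
  closed bulk element, where that function is affine. This admits bulk functions in the boundary
  forms.\<close>

lemma U_bulk_subset_U_surf:
  fixes \<Omega> :: "'a::euclidean_space set"
  assumes \<Omega>: "convex_polytopal_domain \<Omega>" and part: "bulk_surface_partitions \<Omega> T T\<^sub>\<Gamma>" and h: "h > 0"
  shows "U_bulk \<Omega> (T h) \<subseteq> U_surf \<Omega> (T\<^sub>\<Gamma> h)"
proof
  interpret finite_element_space "DIM('a)" "closure \<Omega>" "T h" lborel \<Omega> grad
    by (rule bulk_finite_element_space[OF assms])
  fix u assume "u \<in> U_bulk \<Omega> (T h)"
  then have u: "u \<in> pw_linear (closure \<Omega>) (T h)" by (simp add: U_bulk_def)
  have "continuous_on (frontier \<Omega>) u"
    using pw_linear_continuous[OF u] by (rule continuous_on_subset) (simp add: frontier_def)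
  moreover have "\<exists>a b. \<forall>x\<in>K. u x = a \<bullet> x + b" if K: "K \<in> T\<^sub>\<Gamma> h" for K
  proof -
    have "\<exists>L\<in>T h. closure K = closure L \<inter> frontier \<Omega>"
      using part h K unfolding bulk_surface_partitions_def by blast
    then obtain L where L: "L \<in> T h" "closure K = closure L \<inter> frontier \<Omega>" by blast
    obtain a b where "\<And>x. x \<in> closure L \<Longrightarrow> u x = a \<bullet> x + b"
      using pw_linear_affine_closure[OF u L(1)] by blast
    moreover have "K \<subseteq> closure L" using L(2) closure_subset[of K] by blast
    ultimately show ?thesis by blast
  qed
  ultimately show "u \<in> U_surf \<Omega> (T\<^sub>\<Gamma> h)" by (simp add: U_surf_def pw_linear_def)
qed

section \<open>The energy identity\<close>

lemma surface_element_pos: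
  fixes \<Omega> :: "'a::euclidean_space set"
  assumes dim: "DIM('a) \<ge> 2" and part: "bulk_surface_partitions \<Omega> T T\<^sub>\<Gamma>" and h: "h > 0"
    and K: "K \<in> T\<^sub>\<Gamma> h"
  shows "emeasure (hausdorff_measure (DIM('a) - 1)) (K \<inter> frontier \<Omega>) > 0"
proof -
  let ?k = "DIM('a) - 1"
  have k: "?k > 0" using dim by simp
  have "simplicial_partition ?k (frontier \<Omega>) (T\<^sub>\<Gamma> h)"
    using part h unfolding bulk_surface_partitions_def by blast
  then have simplex: "open_simplex ?k K" and "closure K \<subseteq> frontier \<Omega>"
    using K unfolding simplicial_partition_def by blast+
  then have "K \<inter> frontier \<Omega> = K" using closure_subset[of K] by blast
  moreover have "hausdorff_outer ?k K > 0"
    by (rule hausdorff_outer_facet_pos[OF refl k open_simplex_props(1,4)[OF simplex]])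
  ultimately show ?thesis
    using emeasure_hausdorff_measure[OF k open_simplex_props(7)[OF simplex]] by simp
qed

theorem lemma2p2:
  fixes \<Omega> :: "(real ^ 'd) set"
    and T\<^sub>h T\<^sub>h\<^sub>\<Gamma> :: "real \<Rightarrow> (real ^ 'd) set set"
    and F G :: "real \<Rightarrow> real"
    and \<beta> T \<tau> h :: real and N n :: nat and \<xi> :: ennreal
    and \<phi> \<mu> \<theta> :: "nat \<Rightarrow> real ^ 'd \<Rightarrow> real"
    and r s :: "nat \<Rightarrow> real"
  assumes dim: "CARD('d) \<in> {2, 3}"
    and domain: "convex_polytopal_domain \<Omega>"
    and partitions: "bulk_surface_partitions \<Omega> T\<^sub>h T\<^sub>h\<^sub>\<Gamma>"
    and potentials: "admissible_potentials \<Omega> T\<^sub>h T\<^sub>h\<^sub>\<Gamma> F G"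
    and beta: "\<beta> > 0"
    and time: "T > 0" "N \<ge> 1" "\<tau> = T / real N" "1 \<le> n" "n \<le> N"
    and h: "h > 0"
    and old: "\<phi> (n - 1) \<in> U_bulk \<Omega> (T\<^sub>h h)"
    and scheme: "scheme_step \<Omega> (T\<^sub>h h) (T\<^sub>h\<^sub>\<Gamma> h) \<beta> \<tau> F G \<xi> n \<phi> \<mu> \<theta> r s"
  shows
    "(\<xi> < \<infinity> \<longrightarrow>
        1/2 * int_bulk \<Omega> (\<lambda>x. (norm (grad (\<phi> n) x))\<^sup>2)
      + 1/2 * int_surf \<Omega> (\<lambda>x. (norm (surface_grad (frontier \<Omega>) (\<phi> n) x))\<^sup>2)
      + \<bar>r n\<bar>\<^sup>2 + \<bar>s n\<bar>\<^sup>2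
      + 1/2 * int_bulk \<Omega> (\<lambda>x. (norm (grad (\<phi> n) x - grad (\<phi> (n - 1)) x))\<^sup>2)
      + 1/2 * int_surf \<Omega> (\<lambda>x. (norm (surface_grad (frontier \<Omega>) (\<phi> n) x
                                      - surface_grad (frontier \<Omega>) (\<phi> (n - 1)) x))\<^sup>2)
      + \<bar>r n - r (n - 1)\<bar>\<^sup>2 + \<bar>s n - s (n - 1)\<bar>\<^sup>2
      + \<tau> * int_bulk \<Omega> (\<lambda>x. (norm (grad (\<mu> n) x))\<^sup>2)
      + \<tau> * int_surf \<Omega> (\<lambda>x. (norm (surface_grad (frontier \<Omega>) (\<theta> n) x))\<^sup>2)
      + enn2real \<xi> * \<tau> *
          int_surf \<Omega> (interp_surf \<Omega> (T\<^sub>h\<^sub>\<Gamma> h) (\<lambda>x. \<bar>\<beta> * \<theta> n x - \<mu> n x\<bar>\<^sup>2))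
      = 1/2 * int_bulk \<Omega> (\<lambda>x. (norm (grad (\<phi> (n - 1)) x))\<^sup>2)
      + 1/2 * int_surf \<Omega> (\<lambda>x. (norm (surface_grad (frontier \<Omega>) (\<phi> (n - 1)) x))\<^sup>2)
      + \<bar>r (n - 1)\<bar>\<^sup>2 + \<bar>s (n - 1)\<bar>\<^sup>2)
   \<and> (\<xi> = \<infinity> \<longrightarrow>
        1/2 * int_bulk \<Omega> (\<lambda>x. (norm (grad (\<phi> n) x))\<^sup>2)
      + 1/2 * int_surf \<Omega> (\<lambda>x. (norm (surface_grad (frontier \<Omega>) (\<phi> n) x))\<^sup>2)
      + \<bar>r n\<bar>\<^sup>2 + \<bar>s n\<bar>\<^sup>2
      + 1/2 * int_bulk \<Omega> (\<lambda>x. (norm (grad (\<phi> n) x - grad (\<phi> (n - 1)) x))\<^sup>2)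
      + 1/2 * int_surf \<Omega> (\<lambda>x. (norm (surface_grad (frontier \<Omega>) (\<phi> n) x
                                      - surface_grad (frontier \<Omega>) (\<phi> (n - 1)) x))\<^sup>2)
      + \<bar>r n - r (n - 1)\<bar>\<^sup>2 + \<bar>s n - s (n - 1)\<bar>\<^sup>2
      + \<tau> * int_bulk \<Omega> (\<lambda>x. (norm (grad (\<mu> n) x))\<^sup>2)
      + \<tau> * int_surf \<Omega> (\<lambda>x. (norm (surface_grad (frontier \<Omega>) (\<theta> n) x))\<^sup>2)
      = 1/2 * int_bulk \<Omega> (\<lambda>x. (norm (grad (\<phi> (n - 1)) x))\<^sup>2)
      + 1/2 * int_surf \<Omega> (\<lambda>x. (norm (surface_grad (frontier \<Omega>) (\<phi> (n - 1)) x))\<^sup>2)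
      + \<bar>r (n - 1)\<bar>\<^sup>2 + \<bar>s (n - 1)\<bar>\<^sup>2
      \<and> (\<forall>x\<in>frontier \<Omega>. \<beta> * \<theta> n x = \<mu> n x))"
proof -
  let ?\<Gamma> = "frontier \<Omega>"
  have dim2: "DIM(real ^ 'd) \<ge> 2" using dim by auto
  interpret B: finite_element_space "DIM(real ^ 'd)" "closure \<Omega>" "T\<^sub>h h" lborel \<Omega> grad
    by (rule bulk_finite_element_space[OF domain partitions h])
  define k where "k = DIM(real ^ 'd) - 1"
  define M :: "(real ^ 'd) measure" where "M = hausdorff_measure k"
  interpret S: finite_element_space k ?\<Gamma> "T\<^sub>h\<^sub>\<Gamma> h" M ?\<Gamma> "surface_grad ?\<Gamma>"
    unfolding M_def k_def by (rule surface_finite_element_space[OF dim2 domain partitions h])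
  have int_B: "int_bulk \<Omega> = B.integ"
    by (simp add: fun_eq_iff int_bulk_def B.integ_def)
  have surface_measure: "surface_measure = completion M"
    unfolding surface_measure_def M_def k_def ..
  have int_S: "int_surf \<Omega> = S.integ"
    by (simp add: fun_eq_iff int_surf_def S.integ_def surface_measure)
  have lump_B: "B.integ (interp_bulk \<Omega> (T\<^sub>h h) g) = B.lumped g" for g
    by (simp add: interp_bulk_def[abs_def] B.lumped_def)
  have lump_S: "S.integ (interp_surf \<Omega> (T\<^sub>h\<^sub>\<Gamma> h) g) = S.lumped g" for g
    by (simp add: interp_surf_def[abs_def] S.lumped_def)
  note sch = scheme[unfolded scheme_step_def int_B int_S lump_B lump_S
      B.dirichlet_def[symmetric] S.dirichlet_def[symmetric]]
  define \<delta> where "\<delta> x = \<phi> n x - \<phi> (n - 1) x" for x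
  define w where "w x = \<beta> * \<theta> n x - \<mu> n x" for x
  have \<tau>: "\<tau> > 0" using time by simp
  have \<phi>n: "\<phi> n \<in> U_bulk \<Omega> (T\<^sub>h h)" and \<mu>: "\<mu> n \<in> U_bulk \<Omega> (T\<^sub>h h)"
    and \<theta>: "\<theta> n \<in> U_surf \<Omega> (T\<^sub>h\<^sub>\<Gamma> h)"
    and eq1: "\<And>\<psi>. \<psi> \<in> U_bulk \<Omega> (T\<^sub>h h) \<Longrightarrow>
        B.lumped (\<lambda>x. bdq \<tau> \<phi> n x * \<psi> x) + B.dirichlet (\<mu> n) \<psi>
        + 1 / \<beta> * S.lumped (\<lambda>x. bdq \<tau> \<phi> n x * \<psi> x) + 1 / \<beta> * S.dirichlet (\<theta> n) \<psi> = 0"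
    and eq2: "\<And>\<eta>. \<eta> \<in> U_surf \<Omega> (T\<^sub>h\<^sub>\<Gamma> h) \<Longrightarrow>
        coeff_rate \<xi> * S.lumped (\<lambda>x. bdq \<tau> \<phi> n x * \<eta> x) + coeff_rate \<xi> * S.dirichlet (\<theta> n) \<eta>
        + coeff_exchange \<xi> * \<beta> * S.lumped (\<lambda>x. (\<beta> * \<theta> n x - \<mu> n x) * \<eta> x) = 0"
    and eq3: "\<And>\<psi>. \<psi> \<in> U_bulk \<Omega> (T\<^sub>h h) \<Longrightarrow>
        B.lumped (\<lambda>x. \<mu> n x * \<psi> x) + S.lumped (\<lambda>x. \<theta> n x * \<psi> x) =
        B.dirichlet (\<phi> n) \<psi> + S.dirichlet (\<phi> n) \<psi>
        + r n / sqrt (E_bulk \<Omega> (T\<^sub>h h) F (\<phi> (n - 1))) * B.lumped (\<lambda>x. deriv F (\<phi> (n - 1) x) * \<psi> x)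
        + s n / sqrt (E_surf \<Omega> (T\<^sub>h\<^sub>\<Gamma> h) G (\<phi> (n - 1))) * S.lumped (\<lambda>x. deriv G (\<phi> (n - 1) x) * \<psi> x)"
    and eq4: "r n = r (n - 1) + 1 / (2 * sqrt (E_bulk \<Omega> (T\<^sub>h h) F (\<phi> (n - 1)))) *
        B.lumped (\<lambda>x. deriv F (\<phi> (n - 1) x) * \<delta> x)"
    and eq5: "s n = s (n - 1) + 1 / (2 * sqrt (E_surf \<Omega> (T\<^sub>h\<^sub>\<Gamma> h) G (\<phi> (n - 1)))) *
        S.lumped (\<lambda>x. deriv G (\<phi> (n - 1) x) * \<delta> x)"
    using sch unfolding \<delta>_def by blast+
  have surf: "u \<in> pw_linear ?\<Gamma> (T\<^sub>h\<^sub>\<Gamma> h)" if "u \<in> U_bulk \<Omega> (T\<^sub>h h)" for u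
    using subsetD[OF U_bulk_subset_U_surf[OF domain partitions h] that] by (simp add: U_surf_def)
  have bulk: "u \<in> pw_linear (closure \<Omega>) (T\<^sub>h h)" if "u \<in> U_bulk \<Omega> (T\<^sub>h h)" for u
    using that by (simp add: U_bulk_def)
  have \<theta>': "\<theta> n \<in> pw_linear ?\<Gamma> (T\<^sub>h\<^sub>\<Gamma> h)" using \<theta> by (simp add: U_surf_def)
  have \<delta>_eq: "\<delta> = (\<lambda>x. 1 * \<phi> n x + (-1) * \<phi> (n - 1) x)" by (simp add: \<delta>_def fun_eq_iff)
  have w_eq: "w = (\<lambda>x. \<beta> * \<theta> n x + (-1) * \<mu> n x)" by (simp add: w_def fun_eq_iff)
  have \<delta>: "\<delta> \<in> U_bulk \<Omega> (T\<^sub>h h)"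
    unfolding U_bulk_def \<delta>_eq by (rule B.pw_linear_combination[OF bulk[OF \<phi>n] bulk[OF old]])
  have w: "w \<in> U_surf \<Omega> (T\<^sub>h\<^sub>\<Gamma> h)"
    unfolding U_surf_def w_eq by (rule S.pw_linear_combination[OF \<theta>' surf[OF \<mu>]])
  have bdq_eq: "bdq \<tau> \<phi> n x * u x = 1 / \<tau> * (u x * \<delta> x)" for u x
    by (simp add: bdq_def \<delta>_def)
  \<comment> \<open>Lumped products with the increment \<delta>, and the lumped square
    \<open>W\<close> of \<open>w\<close>. Apart from Dirichlet forms and scalars, these are the only
    quantities in the tested equations.\<close>
  define a b\<^sub>\<mu> b\<^sub>\<theta> W where "a = B.lumped (\<lambda>x. \<mu> n x * \<delta> x)"
    and "b\<^sub>\<mu> = S.lumped (\<lambda>x. \<mu> n x * \<delta> x)" and "b\<^sub>\<theta> = S.lumped (\<lambda>x. \<theta> n x * \<delta> x)"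
    and "W = S.lumped (\<lambda>x. w x * w x)"
  have lump_w: "S.lumped (\<lambda>x. w x * \<delta> x) = \<beta> * b\<^sub>\<theta> - b\<^sub>\<mu>"
  proof -
    have "(\<lambda>x. w x * \<delta> x) = (\<lambda>x. \<beta> * (\<theta> n x * \<delta> x) + (-1) * (\<mu> n x * \<delta> x))"
      by (simp add: fun_eq_iff w_def algebra_simps)
    then have "S.lumped (\<lambda>x. w x * \<delta> x) = \<beta> * b\<^sub>\<theta> + (-1) * b\<^sub>\<mu>"
      by (simp only: S.lumped_combination b\<^sub>\<theta>_def b\<^sub>\<mu>_def)
    then show ?thesis by simp
  qed
  have dir_w: "S.dirichlet (\<theta> n) w = \<beta> * S.dirichlet (\<theta> n) (\<theta> n) - S.dirichlet (\<theta> n) (\<mu> n)"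
    unfolding w_eq using S.dirichlet_combination[OF \<theta>' \<theta>' surf[OF \<mu>], of \<beta> "-1"] by simp
  have test1: "1 / \<tau> * a + B.dirichlet (\<mu> n) (\<mu> n) + 1 / \<beta> * (1 / \<tau> * b\<^sub>\<mu>)
      + 1 / \<beta> * S.dirichlet (\<theta> n) (\<mu> n) = 0"
    using eq1[OF \<mu>] by (simp only: bdq_eq B.lumped_scale S.lumped_scale a_def b\<^sub>\<mu>_def)
  have test2: "coeff_rate \<xi> * (1 / \<tau> * (\<beta> * b\<^sub>\<theta> - b\<^sub>\<mu>))
      + coeff_rate \<xi> * (\<beta> * S.dirichlet (\<theta> n) (\<theta> n) - S.dirichlet (\<theta> n) (\<mu> n))
      + coeff_exchange \<xi> * \<beta> * W = 0"
    using eq2[OF w] by (simp only: bdq_eq S.lumped_scale lump_w dir_w W_def w_def[symmetric])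
  have test3: "a + b\<^sub>\<theta> = B.dirichlet (\<phi> n) \<delta> + S.dirichlet (\<phi> n) \<delta>
      + ((r n)\<^sup>2 + (r n - r (n - 1))\<^sup>2 - (r (n - 1))\<^sup>2)
      + ((s n)\<^sup>2 + (s n - s (n - 1))\<^sup>2 - (s (n - 1))\<^sup>2)"
  proof -
    have coupling: "y / q * X = y\<^sup>2 + (y - y')\<^sup>2 - y'\<^sup>2" if "y = y' + 1 / (2 * q) * X" for y y' q X :: real
    proof -
      have "X / q = 2 * (y - y')" using that by simp
      then have "y / q * X = y * (2 * (y - y'))" by (metis times_divide_eq_left times_divide_eq_right)
      then show ?thesis by (simp add: power2_eq_square algebra_simps)
    qed
    show ?thesis using eq3[OF \<delta>] coupling[OF eq4] coupling[OF eq5] by (simp only: a_def b\<^sub>\<theta>_def)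
  qed
  \<comment> \<open>The two cases differ only in how \<open>exchange\<close> is obtained;
    \<open>c\<close> is \<xi> when \<xi> is finite and 0 otherwise.\<close>
  have energy: "1/2 * B.integ (\<lambda>x. (norm (grad (\<phi> n) x))\<^sup>2)
      + 1/2 * S.integ (\<lambda>x. (norm (surface_grad ?\<Gamma> (\<phi> n) x))\<^sup>2)
      + \<bar>r n\<bar>\<^sup>2 + \<bar>s n\<bar>\<^sup>2
      + 1/2 * B.integ (\<lambda>x. (norm (grad (\<phi> n) x - grad (\<phi> (n - 1)) x))\<^sup>2)
      + 1/2 * S.integ (\<lambda>x. (norm (surface_grad ?\<Gamma> (\<phi> n) x - surface_grad ?\<Gamma> (\<phi> (n - 1)) x))\<^sup>2)
      + \<bar>r n - r (n - 1)\<bar>\<^sup>2 + \<bar>s n - s (n - 1)\<bar>\<^sup>2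
      + \<tau> * B.integ (\<lambda>x. (norm (grad (\<mu> n) x))\<^sup>2)
      + \<tau> * S.integ (\<lambda>x. (norm (surface_grad ?\<Gamma> (\<theta> n) x))\<^sup>2)
      + c * \<tau> * W
      = 1/2 * B.integ (\<lambda>x. (norm (grad (\<phi> (n - 1)) x))\<^sup>2)
      + 1/2 * S.integ (\<lambda>x. (norm (surface_grad ?\<Gamma> (\<phi> (n - 1)) x))\<^sup>2)
      + \<bar>r (n - 1)\<bar>\<^sup>2 + \<bar>s (n - 1)\<bar>\<^sup>2"
    if exchange: "1 / \<tau> * (\<beta> * b\<^sub>\<theta> - b\<^sub>\<mu>)
      + (\<beta> * S.dirichlet (\<theta> n) (\<theta> n) - S.dirichlet (\<theta> n) (\<mu> n)) + c * \<beta> * W = 0" for c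
  proof -
    \<comment> \<open>Once divided by \<beta>, \<open>exchange\<close> contains
      \<open>b\<^sub>\<mu>\<close> and the mixed Dirichlet term of \<theta> and \<mu> with signs
      opposite to those in \<open>test1\<close>; adding the two removes both.\<close>
    have "1 / \<beta> * (t * (\<beta> * p - q) + (\<beta> * u - v) + c * \<beta> * W)
        = t * p - 1 / \<beta> * (t * q) + u - 1 / \<beta> * v + c * W" for t p q u v
      using beta by (simp add: field_simps)
    from this[of "1 / \<tau>" b\<^sub>\<theta> b\<^sub>\<mu> "S.dirichlet (\<theta> n) (\<theta> n)" "S.dirichlet (\<theta> n) (\<mu> n)"]
    have "1 / \<tau> * b\<^sub>\<theta> - 1 / \<beta> * (1 / \<tau> * b\<^sub>\<mu>) + S.dirichlet (\<theta> n) (\<theta> n)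
        - 1 / \<beta> * S.dirichlet (\<theta> n) (\<mu> n) + c * W = 0"
      unfolding exchange by simp
    with test1 have "1 / \<tau> * (a + b\<^sub>\<theta>) + B.dirichlet (\<mu> n) (\<mu> n) + S.dirichlet (\<theta> n) (\<theta> n) + c * W = 0"
      by (simp add: distrib_left)
    moreover have "\<tau> * (1 / \<tau> * y + u + v + c * W) = y + (\<tau> * u + \<tau> * v + c * \<tau> * W)" for y u v
      using \<tau> by (simp add: field_simps)
    ultimately have dissipation:
      "a + b\<^sub>\<theta> + (\<tau> * B.dirichlet (\<mu> n) (\<mu> n) + \<tau> * S.dirichlet (\<theta> n) (\<theta> n) + c * \<tau> * W) = 0"
      by (metis mult_zero_right)
    have dB: "B.dirichlet (\<phi> n) \<delta> = B.dirichlet (\<phi> n) (\<phi> n) - B.dirichlet (\<phi> n) (\<phi> (n - 1))"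
      unfolding \<delta>_def by (rule B.dirichlet_diff[OF bulk[OF \<phi>n] bulk[OF old]])
    have dS: "S.dirichlet (\<phi> n) \<delta> = S.dirichlet (\<phi> n) (\<phi> n) - S.dirichlet (\<phi> n) (\<phi> (n - 1))"
      unfolding \<delta>_def by (rule S.dirichlet_diff[OF surf[OF \<phi>n] surf[OF old]])
    show ?thesis
      unfolding B.integ_norm_grd S.integ_norm_grd B.integ_norm_grd_diff[OF bulk[OF \<phi>n] bulk[OF old]]
        S.integ_norm_grd_diff[OF surf[OF \<phi>n] surf[OF old]] power2_abs
      using test3 dissipation unfolding dB dS by (simp add: algebra_simps)
  qed
  show ?thesis
    unfolding int_B int_S lump_S
  proof (intro conjI impI)
    assume fin: "\<xi> < \<infinity>"
    define x where "x = enn2real \<xi>"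
    have x: "x \<ge> 0" by (simp add: x_def)
    have rate: "coeff_rate \<xi> = 1 / (1 + x)" "coeff_exchange \<xi> = x / (1 + x)"
      using fin by (auto simp: coeff_rate_def coeff_exchange_def x_def)
    \<comment> \<open>Removes the common denominator \<open>1 + \<xi>\<close> of the two
      coefficients.\<close>
    have clear: "X + Y + z * Z = 0" if "1 / y * X + 1 / y * Y + z / y * Z = 0" "y > 0" for X Y Z y z :: real
    proof -
      have "(X + Y + z * Z) / y = 0" using that(1) by (simp add: add_divide_distrib)
      then show ?thesis using that(2) by simp
    qed
    have "1 / \<tau> * (\<beta> * b\<^sub>\<theta> - b\<^sub>\<mu>)
        + (\<beta> * S.dirichlet (\<theta> n) (\<theta> n) - S.dirichlet (\<theta> n) (\<mu> n)) + x * \<beta> * W = 0"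
      using clear[OF test2[unfolded rate mult.assoc[of _ \<beta> W]]] x by (simp only: mult.assoc)
    note energy[OF this]
    moreover have "S.lumped (\<lambda>x. \<bar>\<beta> * \<theta> n x - \<mu> n x\<bar>\<^sup>2) = W"
      by (simp add: W_def w_def power2_eq_square)
    ultimately show "1/2 * B.integ (\<lambda>x. (norm (grad (\<phi> n) x))\<^sup>2)
      + 1/2 * S.integ (\<lambda>x. (norm (surface_grad ?\<Gamma> (\<phi> n) x))\<^sup>2)
      + \<bar>r n\<bar>\<^sup>2 + \<bar>s n\<bar>\<^sup>2
      + 1/2 * B.integ (\<lambda>x. (norm (grad (\<phi> n) x - grad (\<phi> (n - 1)) x))\<^sup>2)
      + 1/2 * S.integ (\<lambda>x. (norm (surface_grad ?\<Gamma> (\<phi> n) x - surface_grad ?\<Gamma> (\<phi> (n - 1)) x))\<^sup>2)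
      + \<bar>r n - r (n - 1)\<bar>\<^sup>2 + \<bar>s n - s (n - 1)\<bar>\<^sup>2
      + \<tau> * B.integ (\<lambda>x. (norm (grad (\<mu> n) x))\<^sup>2)
      + \<tau> * S.integ (\<lambda>x. (norm (surface_grad ?\<Gamma> (\<theta> n) x))\<^sup>2)
      + enn2real \<xi> * \<tau> * S.lumped (\<lambda>x. \<bar>\<beta> * \<theta> n x - \<mu> n x\<bar>\<^sup>2)
      = 1/2 * B.integ (\<lambda>x. (norm (grad (\<phi> (n - 1)) x))\<^sup>2)
      + 1/2 * S.integ (\<lambda>x. (norm (surface_grad ?\<Gamma> (\<phi> (n - 1)) x))\<^sup>2)
      + \<bar>r (n - 1)\<bar>\<^sup>2 + \<bar>s (n - 1)\<bar>\<^sup>2"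
      by (simp only: x_def)
  next
    assume inf: "\<xi> = \<infinity>"
    then have W0: "W = 0" using test2 beta by (simp add: coeff_rate_def coeff_exchange_def)
    have nodes: "w p = 0" if p: "p \<in> nodes (T\<^sub>h\<^sub>\<Gamma> h)" for p
    proof -
      have "w p * w p = 0"
        using S.lumped_zero_imp_zero[of "\<lambda>x. w x * w x" p] W0 p
          surface_element_pos[OF dim2 partitions h, folded k_def, folded M_def]
        by (simp add: W_def)
      then show ?thesis by simp
    qed
    have zero: "(\<lambda>x. 0) \<in> pw_linear ?\<Gamma> (T\<^sub>h\<^sub>\<Gamma> h)"
      using S.pw_linear_combination[OF \<theta>' \<theta>', of 0 0] by simp
    have "w x = 0" if "x \<in> ?\<Gamma>" for x
      by (rule S.pw_linear_eqI[OF _ zero nodes that]) (use w in \<open>simp add: U_surf_def\<close>)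
    then have eq: "\<beta> * \<theta> n x = \<mu> n x" if "x \<in> ?\<Gamma>" for x using that by (simp add: w_def)
    then show "\<forall>x\<in>?\<Gamma>. \<beta> * \<theta> n x = \<mu> n x" by blast
    \<comment> \<open>With rate coefficient 0 the second equation carries no rate terms, so
      \<open>exchange\<close> is verified with \<open>c = 0\<close> piece by piece: \<beta> \<theta>
      and \<mu> agree on the boundary and hence have equal lumped products and equal Dirichlet
      forms.\<close>
    have "b\<^sub>\<mu> = S.lumped (\<lambda>x. \<beta> * (\<theta> n x * \<delta> x))"
      unfolding b\<^sub>\<mu>_def by (rule S.lumped_cong) (simp add: eq[symmetric])
    then have 1: "\<beta> * b\<^sub>\<theta> - b\<^sub>\<mu> = 0" by (simp add: S.lumped_scale b\<^sub>\<theta>_def)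
    have "S.dirichlet (\<theta> n) (\<lambda>x. \<beta> * \<theta> n x) = S.dirichlet (\<theta> n) (\<mu> n)"
      by (rule S.dirichlet_cong[OF surf[OF \<mu>] _ \<theta>']) (simp add: eq)
    then have 2: "\<beta> * S.dirichlet (\<theta> n) (\<theta> n) - S.dirichlet (\<theta> n) (\<mu> n) = 0"
      using S.dirichlet_combination[OF \<theta>' \<theta>' \<theta>', of \<beta> 0] by simp
    show "1/2 * B.integ (\<lambda>x. (norm (grad (\<phi> n) x))\<^sup>2)
      + 1/2 * S.integ (\<lambda>x. (norm (surface_grad ?\<Gamma> (\<phi> n) x))\<^sup>2)
      + \<bar>r n\<bar>\<^sup>2 + \<bar>s n\<bar>\<^sup>2
      + 1/2 * B.integ (\<lambda>x. (norm (grad (\<phi> n) x - grad (\<phi> (n - 1)) x))\<^sup>2)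
      + 1/2 * S.integ (\<lambda>x. (norm (surface_grad ?\<Gamma> (\<phi> n) x - surface_grad ?\<Gamma> (\<phi> (n - 1)) x))\<^sup>2)
      + \<bar>r n - r (n - 1)\<bar>\<^sup>2 + \<bar>s n - s (n - 1)\<bar>\<^sup>2
      + \<tau> * B.integ (\<lambda>x. (norm (grad (\<mu> n) x))\<^sup>2)
      + \<tau> * S.integ (\<lambda>x. (norm (surface_grad ?\<Gamma> (\<theta> n) x))\<^sup>2)
      = 1/2 * B.integ (\<lambda>x. (norm (grad (\<phi> (n - 1)) x))\<^sup>2)
      + 1/2 * S.integ (\<lambda>x. (norm (surface_grad ?\<Gamma> (\<phi> (n - 1)) x))\<^sup>2)
      + \<bar>r (n - 1)\<bar>\<^sup>2 + \<bar>s (n - 1)\<bar>\<^sup>2"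
      using energy[of 0] by (simp add: 1 2)
  qed
qed

end
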